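(* Let $C_1,C_2$ be real symmetric $3\times3$ matrices satisfying the standing assumptions (given in the context), and let $\lambda_1>\lambda_2>\lambda_3>0$ be the eigenvalues of $C_1^{-1}C_2$. Let $\boldsymbol\nu=(\nu_1,\nu_2)$ and $\boldsymbol\mu=(\mu_1,\mu_2)$ in $\mathbb R^2$ satisfy $\nu_2>0$, $\nu_1+\lambda_3\nu_2>0$, $\mu_2>0$, $\mu_1+\lambda_3\mu_2>0$, so that the ellipses $\mathcal C_{\boldsymbol\nu}$ and $\mathcal C_{\boldsymbol\mu}$ are both in the interior of $\mathcal C_1$. Let $\rho(\boldsymbol\mu)$ and $\rho(\boldsymbol\nu)$ be the rotation numbers of the Poncelet maps $P_{\boldsymbol\mu}$ and $P_{\boldsymbol\nu}$. Then the following are equivalent: 1. $\mathcal C_{\boldsymbol\mu}\subset\operatorname{Int}(\mathcal C_{\boldsymbol\nu})$; 2. $\boldsymbol\nu\times\boldsymbol\mu>0$, where $\boldsymbol\nu\times\boldsymbol\mu=\nu_1\mu_2-\nu_2\mu_1$; 3. $\rho(\boldsymbol\mu)>\rho(\boldsymbol\nu)$.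
   Context: A real symmetric $3\times3$ matrix $C$ defines the conic $\mathcal C=\{(x,y)\in\mathbb R^2:\mathbf u^TC\mathbf u=0,\ \mathbf u=(x,y,1)^T\}$. Standing assumptions on $(C_1,C_2)$: (i) for $i=1,2$ the upper-left $2\times2$ block of $C_i$ is positive definite and $\det C_i<0$; (ii) $C_1^{-1}C_2$ has three positive, distinct eigenvalues; (iii) whenever $\mathbf u\in\mathbb R^3$, $\mathbf u\ne0$ and $\mathbf u^TC_2\mathbf u=0$, then $\mathbf u^TC_1\mathbf u<0$ (the ellipse $\mathcal C_2$ is inside the ellipse $\mathcal C_1$). For $\boldsymbol\nu=(\nu_1,\nu_2)$ let $C_{\boldsymbol\nu}=\nu_1C_1+\nu_2C_2$, with conic $\mathcal C_{\boldsymbol\nu}$ and interior $\operatorname{Int}(\mathcal C_{\boldsymbol\nu})=\{(x,y)\in\mathbb R^2:\mathbf u^TC_{\boldsymbol\nu}\mathbf u<0,\ \mathbf u=(x,y,1)^T\}$. Poncelet map: for $\boldsymbol\nu$ with $\nu_2>0$, $\nu_1+\lambda_3\nu_2>0$ and $z_0\in\mathcal C_1$, $P_{\boldsymbol\nu}(z_0)=z_1$ is the unique point of $\mathcal C_1$ such that the segment from $z_0$ to $z_1$ is tangent to $\mathcal C_{\boldsymbol\nu}$ with $\mathcal C_{\boldsymbol\nu}$ on the left when moving from $z_0$ to $z_1$. Rotation number: it is given by $\rho(\boldsymbol\nu)=\frac{F(\omega(\boldsymbol\nu),e)}{2K(e)}\in(0,\tfrac12)$ with $\omega(\boldsymbol\nu)=\arcsin\sqrt{\frac{(\lambda_1-\lambda_3)\nu_2}{\lambda_1\nu_2+\nu_1}}$,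 $e=\sqrt{\frac{\lambda_1-\lambda_2}{\lambda_1-\lambda_3}}$, $F(\phi,e)=\int_0^\phi\frac{d\tau}{\sqrt{1-e^2\sin^2\tau}}$, $K(e)=F(\pi/2,e)$. *)

theory Defs
  imports "HOL-Analysis.Analysis"
begin

definition eigenvalues :: "real ^ 'n ^ 'n \<Rightarrow> real set" where
  "eigenvalues A = {l. \<exists>v. v \<noteq> 0 \<and> A *v v = l *\<^sub>R v}"

definition positive_definite :: "real ^ 'n ^ 'n \<Rightarrow> bool" where
  "positive_definite A \<longleftrightarrow> transpose A = A \<and> (\<forall>v. v \<noteq> 0 \<longrightarrow> v \<bullet> (A *v v) > 0)"

definition upper_left :: "real ^ 3 ^ 3 \<Rightarrow> real ^ 2 ^ 2" where
  "upper_left C = vector [vector [C $ 1 $ 1, C $ 1 $ 2], vector [C $ 2 $ 1, C $ 2 $ 2]]"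

definition homog :: "real \<times> real \<Rightarrow> real ^ 3" where
  "homog p = vector [fst p, snd p, 1]"

definition conic_curve :: "real ^ 3 ^ 3 \<Rightarrow> (real \<times> real) set" where
  "conic_curve C = {p. homog p \<bullet> (C *v homog p) = 0}"

definition conic_interior :: "real ^ 3 ^ 3 \<Rightarrow> (real \<times> real) set" where
  "conic_interior C = {p. homog p \<bullet> (C *v homog p) < 0}"

definition pencil :: "real ^ 3 ^ 3 \<Rightarrow> real ^ 3 ^ 3 \<Rightarrow> real \<times> real \<Rightarrow> real ^ 3 ^ 3" where
  "pencil C1 C2 \<nu> = fst \<nu> *\<^sub>R C1 + snd \<nu> *\<^sub>R C2"

definition cross2 :: "real \<times> real \<Rightarrow> real \<times> real \<Rightarrow> real" where
  "cross2 v w = fst v * snd w - snd v * fst w"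

(* The polar of p; it is the tangent line at p when p lies on a nondegenerate conic. *)
definition tangent_line :: "real ^ 3 ^ 3 \<Rightarrow> real \<times> real \<Rightarrow> (real \<times> real) set" where
  "tangent_line C p = {q. homog p \<bullet> (C *v homog q) = 0}"

definition tangent_segment :: "real ^ 3 ^ 3 \<Rightarrow> real \<times> real \<Rightarrow> real \<times> real \<Rightarrow> bool" where
  "tangent_segment C z0 z1 \<longleftrightarrow> z0 \<noteq> z1 \<and>
     (\<exists>p \<in> conic_curve C \<inter> closed_segment z0 z1. closed_segment z0 z1 \<subseteq> tangent_line C p)"

definition on_left :: "(real \<times> real) set \<Rightarrow> real \<times> real \<Rightarrow> real \<times> real \<Rightarrow> bool" where
  "on_left S z0 z1 \<longleftrightarrow> (\<forall>q \<in> S. cross2 (z1 - z0) (q - z0) \<ge> 0)"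

definition poncelet_map ::
    "real ^ 3 ^ 3 \<Rightarrow> real ^ 3 ^ 3 \<Rightarrow> real \<times> real \<Rightarrow> real \<times> real \<Rightarrow> real \<times> real" where
  "poncelet_map C1 C2 \<nu> z0 =
     (THE z1. z1 \<in> conic_curve C1 \<and> tangent_segment (pencil C1 C2 \<nu>) z0 z1 \<and>
              on_left (conic_curve (pencil C1 C2 \<nu>)) z0 z1)"

(* For an ellipse, the pole of the line at infinity is its centre. *)
definition conic_centre :: "real ^ 3 ^ 3 \<Rightarrow> real \<times> real" where
  "conic_centre C = (THE p. (C *v homog p) $ 1 = 0 \<and> (C *v homog p) $ 2 = 0)"

(* Counterclockwise parametrisation of an ellipse, of period 1, by the angle seen from the centre. *)
definition ellipse_param :: "real ^ 3 ^ 3 \<Rightarrow> real \<Rightarrow> real \<times> real" where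
  "ellipse_param C t = (THE z. z \<in> conic_curve C \<and>
     (\<exists>r>0. z = conic_centre C + r *\<^sub>R (cos (2 * pi * t), sin (2 * pi * t))))"

definition circle_lift :: "(real \<Rightarrow> 'a) \<Rightarrow> ('a \<Rightarrow> 'a) \<Rightarrow> (real \<Rightarrow> real) \<Rightarrow> bool" where
  "circle_lift \<gamma> f F \<longleftrightarrow> continuous_on UNIV F \<and> (\<forall>t. F (t + 1) = F t + 1) \<and>
     (\<forall>t. \<gamma> (F t) = f (\<gamma> t))"

(* Rotation number, counted in full turns, of a self-map f of the closed curve parametrised with
   period 1 by \<gamma>. Two lifts differ by an integer constant, which changes the limit by that integer;
   the representative in [0,1) is taken. The value does not change under an orientation-preserving
   reparametrisation of the curve. *)
definition rotation_number :: "(real \<Rightarrow> 'a) \<Rightarrow> ('a \<Rightarrow> 'a) \<Rightarrow> real" where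
  "rotation_number \<gamma> f = (THE r. 0 \<le> r \<and> r < 1 \<and>
     (\<exists>F. circle_lift \<gamma> f F \<and> (\<forall>t. (\<lambda>n. ((F ^^ n) t - t) / real n) \<longlonglongrightarrow> r)))"

definition poncelet_rotation_number ::
    "real ^ 3 ^ 3 \<Rightarrow> real ^ 3 ^ 3 \<Rightarrow> real \<times> real \<Rightarrow> real" where
  "poncelet_rotation_number C1 C2 \<nu> =
     rotation_number (ellipse_param C1) (poncelet_map C1 C2 \<nu>)"

end

theory Submission
  imports Defs
begin

text \<open>
  The inclusion statement is linear algebra. On the conic of \<open>\<mu>\<close> one has
  \<open>\<mu>\<^sub>1 C\<^sub>1 + \<mu>\<^sub>2 C\<^sub>2 = 0\<close>, hence \<open>\<mu>\<^sub>2 C\<^sub>\<nu> = (\<nu> \<times> \<mu>) C\<^sub>1\<close> there, and \<open>C\<^sub>1\<close> is negative on that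
  conic; so every point of it lies inside the conic of \<open>\<nu>\<close> when \<open>\<nu> \<times> \<mu> > 0\<close>, and none does
  otherwise. The conic of \<open>\<mu>\<close> is not empty.

  For the rotation numbers the point is that one and the same measure on the outer ellipse is
  invariant under all the Poncelet maps of the pencil. A common eigenbasis turns the two forms into
  \<open>x\<^sup>2 + y\<^sup>2 - z\<^sup>2\<close> and \<open>\<lambda>\<^sub>1 x\<^sup>2 + \<lambda>\<^sub>2 y\<^sup>2 - \<lambda>\<^sub>3 z\<^sup>2\<close> (\<open>common_frame_exists\<close>), so after a projective change of
  coordinates the outer ellipse is the unit circle and the inner one is
  \<open>x\<^sup>2 / a + y\<^sup>2 / b = 1\<close> with \<open>0 < a < b < 1\<close>. The frame is chosen so that the change of coordinates is
  defined on the closed disc and preserves orientation; hence chords, tangency and sides are the same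
  in both pictures. The chord from angle \<open>s - d\<close> to angle \<open>s + d\<close> is tangent to the inner
  ellipse, with the ellipse on its left, exactly when \<open>cos d = sqrt (a cos\<^sup>2 s + b sin\<^sup>2 s)\<close>. Call this
  \<open>d\<close> the half-chord \<open>d(s)\<close>.

  On the unit circle the form of \<open>C\<^sub>2\<close> is
  \<open>w\<^sup>2(\<theta>) = (\<lambda>\<^sub>1 - \<lambda>\<^sub>3) cos\<^sup>2 \<theta> + (\<lambda>\<^sub>2 - \<lambda>\<^sub>3) sin\<^sup>2 \<theta>\<close>, and every form of the pencil is a multiple of it
  there. The velocities of the two endpoints \<open>s \<mp> d(s)\<close> turn out to be proportional, with the
  same factor, to the values of \<open>w\<close> at these endpoints (\<open>chord_endpoint_weight\<close>). So if \<open>H\<close> is an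
  antiderivative of \<open>1 / w\<close>, then \<open>H(s + d(s)) - H(s - d(s))\<close> does not depend on \<open>s\<close>
  (\<open>chord_measure_constant\<close>): in the coordinate \<open>H\<close> the Poncelet map is a translation. Its
  rotation number is therefore the translation length divided by the full length,
  \<open>(H(d(0)) - H(- d(0))) / (H(2\<pi>) - H(0))\<close> (\<open>poncelet_rotation_number_eq\<close>). As \<open>H\<close> is the same
  for \<open>\<mu>\<close> and \<open>\<nu>\<close>, comparing the rotation numbers means comparing
  \<open>cos\<^sup>2 d(0) = a = (\<nu>\<^sub>1 + \<lambda>\<^sub>3 \<nu>\<^sub>2) / (\<nu>\<^sub>1 + \<lambda>\<^sub>1 \<nu>\<^sub>2)\<close>, and that comparison has the sign of \<open>\<nu> \<times> \<mu>\<close>.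

  The rotation number is measured in the angle seen from the centre of the outer ellipse. That
  angle is an increasing reparametrisation of the angle on the unit circle
  (\<open>ellipse_param_reparametrizes\<close>), and a conjugacy to a translation determines the rotation number
  whatever the parametrisation (\<open>rotation_number_eqI\<close>).
\<close>

section \<open>Rotation numbers of maps conjugate to a translation\<close>

lemma surj_of_quasiperiodic:
  fixes J :: "real \<Rightarrow> real"
  assumes cont: "continuous_on UNIV J" and p: "p > 0" and q: "q > 0"
    and per: "\<And>t. J (t + p) = J t + q"
  shows "surj J"
proof -
  have shift: "J (t + of_nat n * p) = J t + of_nat n * q" for n t
  proof (induction n)
    case (Suc n)
    have "J (t + of_nat (Suc n) * p) = J ((t + of_nat n * p) + p)" by (simp add: algebra_simps)
    also have "\<dots> = J (t + of_nat n * p) + q" by (rule per)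
    finally show ?case using Suc by (simp add: algebra_simps)
  qed simp
  have "\<exists>x. J x = y" for y
  proof -
    obtain n :: nat where "real n > \<bar>y - J 0\<bar> / q" using reals_Archimedean2 by blast
    then have n: "real n * q > \<bar>y - J 0\<bar>" using q by (simp add: field_simps)
    have lo: "J (- real n * p) = J 0 - real n * q" using shift[of "- real n * p" n] by simp
    have hi: "J (real n * p) = J 0 + real n * q" using shift[of 0 n] by simp
    have "\<exists>x\<ge>- real n * p. x \<le> real n * p \<and> J x = y"
    proof (rule IVT')
      show "J (- real n * p) \<le> y" "y \<le> J (real n * p)" using lo hi n by linarith+
      have "0 \<le> real n * p" using p by simp
      then show "- real n * p \<le> real n * p" by simp
      show "continuous_on {- real n * p..real n * p} J" using cont continuous_on_subset by blast
    qed
    then show ?thesis by blast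
  qed
  then show ?thesis unfolding surj_def by metis
qed

lemma continuous_strict_mono_inverse:
  fixes J :: "real \<Rightarrow> real"
  assumes "strict_mono J" "surj J"
  shows "continuous_on UNIV (inv J)" "strict_mono (inv J)"
proof -
  have le: "x \<le> y \<longleftrightarrow> J x \<le> J y" for x y
    using assms(1) by (simp add: strict_mono_less_eq)
  have lt: "x < y \<longleftrightarrow> J x < J y" for x y
    using assms(1) by (simp add: strict_mono_less)
  have Ji: "J (inv J y) = y" for y using assms(2) by (simp add: surj_f_inv_f)
  have "range (inv J) = UNIV"
    using inj_imp_surj_inv[OF strict_mono_imp_inj_on[OF assms(1)]] .
  then show "continuous_on UNIV (inv J)"
    by (intro continuous_onI_mono) (simp_all add: le[of "inv J _"] Ji)
  show "strict_mono (inv J)" by (intro strict_monoI) (simp add: lt[of "inv J _"] Ji)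
qed

lemma continuous_int_constant:
  fixes f :: "real \<Rightarrow> real"
  assumes "continuous_on UNIV f" "\<And>t. f t \<in> \<int>"
  obtains k :: int where "\<And>t. f t = of_int k"
proof -
  have "f constant_on UNIV"
  proof (rule continuous_discrete_range_constant)
    show "\<exists>e>0. \<forall>y. y \<in> UNIV \<and> f y \<noteq> f x \<longrightarrow> e \<le> norm (f y - f x)" for x
    proof (intro exI[of _ 1] conjI allI impI)
      fix y assume "y \<in> UNIV \<and> f y \<noteq> f x"
      moreover obtain i j where "f y = of_int i" "f x = of_int j"
        using assms(2) by (meson Ints_cases)
      ultimately show "1 \<le> norm (f y - f x)" by simp
    qed simp
  qed (use assms in auto)
  then show ?thesis using that assms(2) unfolding constant_on_def by (metis Ints_cases UNIV_I)
qed

text \<open>A coordinate \<open>J\<close> of degree one differs from the identity by a bounded amount, so the average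
displacement of an orbit may be measured in \<open>J\<close>, where every step has the same length. Any other
lift differs by an integer constant, and the condition \<open>0 \<le> r < 1\<close> singles out one value.\<close>

lemma rotation_number_eqI:
  fixes J :: "real \<Rightarrow> real"
  assumes inj: "\<And>s t. \<gamma> s = \<gamma> t \<Longrightarrow> s - t \<in> \<int>"
    and cont: "continuous_on UNIV J" and mono: "strict_mono J" and per: "\<And>t. J (t + 1) = J t + 1"
    and conj: "\<And>t t'. J t' = J t + \<rho> \<Longrightarrow> f (\<gamma> t) = \<gamma> t'"
    and \<rho>: "0 \<le> \<rho>" "\<rho> < 1"
  shows "rotation_number \<gamma> f = \<rho>"
proof -
  have sj: "surj J" using surj_of_quasiperiodic[OF cont _ _ per] by simp
  have Ji: "J (inv J y) = y" for y using sj by (simp add: surj_f_inv_f)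
  have injJ: "J x = J y \<Longrightarrow> x = y" for x y using mono by (simp add: strict_mono_eq)
  define F where "F = (\<lambda>t. inv J (J t + \<rho>))"
  have JF: "J (F t) = J t + \<rho>" for t by (simp add: F_def Ji)
  have contF: "continuous_on UNIV F"
    unfolding F_def
    by (rule continuous_on_compose2[OF continuous_strict_mono_inverse(1)[OF mono sj]])
       (auto intro!: continuous_intros cont)
  have lift: "circle_lift \<gamma> f F"
    unfolding circle_lift_def
  proof (intro conjI allI contF)
    show "F (t + 1) = F t + 1" for t by (rule injJ) (simp add: JF per)
    show "\<gamma> (F t) = f (\<gamma> t)" for t using conj[OF JF] by simp
  qed
  have perk: "J (t + of_int k) = J t + of_int k" for t k
  proof (induction k rule: int_induct[where k = 0])
    case (step1 i)
    then show ?case using per[of "t + of_int i"] by (simp add: algebra_simps)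
  next
    case (step2 i)
    then show ?case using per[of "t + of_int (i - 1)"] by (simp add: algebra_simps)
  qed simp
  \<comment> \<open>Compare with the neighbouring integers, at which \<open>J\<close> is \<open>J 0\<close> plus the integer.\<close>
  have near: "\<bar>J t - t\<bar> \<le> \<bar>J 0\<bar> + 1" for t
  proof -
    have "J (of_int \<lfloor>t\<rfloor>) \<le> J t" "J t \<le> J (of_int (\<lfloor>t\<rfloor> + 1))"
      unfolding strict_mono_less_eq[OF mono] by linarith+
    then have "J 0 + of_int \<lfloor>t\<rfloor> \<le> J t" "J t \<le> J 0 + (of_int \<lfloor>t\<rfloor> + 1)"
      using perk[of 0 "\<lfloor>t\<rfloor>"] perk[of 0 "\<lfloor>t\<rfloor> + 1"] by simp_all
    then show ?thesis by linarith
  qed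
  have limit: "(\<lambda>n. ((G ^^ n) t - t) / real n) \<longlonglongrightarrow> c"
    if G: "\<And>t. J (G t) = J t + c" for G c t
  proof -
    have it: "J ((G ^^ n) t) = J t + real n * c" for n
      by (induction n) (simp_all add: G algebra_simps)
    have "(\<lambda>n. ((G ^^ n) t - t) / real n - c) \<longlonglongrightarrow> 0"
    proof (rule Lim_null_comparison)
      show "(\<lambda>n. (2 * \<bar>J 0\<bar> + 2) * (1 / real n)) \<longlonglongrightarrow> 0"
        using tendsto_mult_right_zero[OF lim_1_over_n] by blast
      have "norm (((G ^^ n) t - t) / real n - c) \<le> (2 * \<bar>J 0\<bar> + 2) * (1 / real n)"
        if "n > 0" for n
      proof -
        have "\<bar>((G ^^ n) t - t) - real n * c\<bar> \<le> 2 * \<bar>J 0\<bar> + 2"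
          using near[of t] near[of "(G ^^ n) t"] it[of n] by linarith
        then have "\<bar>((G ^^ n) t - t) - real n * c\<bar> / real n \<le> (2 * \<bar>J 0\<bar> + 2) / real n"
          using that by (simp add: divide_right_mono)
        moreover have "((G ^^ n) t - t) / real n - c = (((G ^^ n) t - t) - real n * c) / real n"
          using that by (simp add: field_simps)
        ultimately show ?thesis by simp
      qed
      then show "\<forall>\<^sub>F n in sequentially. norm (((G ^^ n) t - t) / real n - c) \<le> (2 * \<bar>J 0\<bar> + 2) * (1 / real n)"
        by (intro eventually_sequentiallyI[of 1]) simp
    qed
    then show ?thesis by (simp add: LIM_zero_iff)
  qed
  show ?thesis
    unfolding rotation_number_def
  proof (rule the_equality)
    show "0 \<le> \<rho> \<and> \<rho> < 1 \<and> (\<exists>F. circle_lift \<gamma> f F \<and> (\<forall>t. (\<lambda>n. ((F ^^ n) t - t) / real n) \<longlonglongrightarrow> \<rho>))"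
      using \<rho> lift limit[OF JF] by blast
  next
    fix r assume r: "0 \<le> r \<and> r < 1 \<and> (\<exists>F. circle_lift \<gamma> f F \<and> (\<forall>t. (\<lambda>n. ((F ^^ n) t - t) / real n) \<longlonglongrightarrow> r))"
    then obtain G where G: "circle_lift \<gamma> f G" and Gr: "(\<lambda>n. ((G ^^ n) 0 - 0) / real n) \<longlonglongrightarrow> r" by blast
    have "G t - F t \<in> \<int>" for t
    proof (rule inj)
      show "\<gamma> (G t) = \<gamma> (F t)" using G lift unfolding circle_lift_def by simp
    qed
    moreover have "continuous_on UNIV (\<lambda>t. G t - F t)"
      using G contF unfolding circle_lift_def by (auto intro!: continuous_intros)
    ultimately obtain k where k: "\<And>t. G t - F t = of_int k"
      using continuous_int_constant by blast
    have "J (G t) = J t + (\<rho> + of_int k)" for t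
    proof -
      have "G t = F t + of_int k" using k[of t] by simp
      then show ?thesis using perk JF by simp
    qed
    from limit[OF this, of 0] Gr have "r = \<rho> + of_int k" using LIMSEQ_unique by blast
    then have "k = 0" using r \<rho> by linarith
    then show "r = \<rho>" using \<open>r = \<rho> + of_int k\<close> by simp
  qed
qed

lemma continuous_antiderivative_exists:
  fixes f :: "real \<Rightarrow> real"
  assumes "continuous_on UNIV f"
  obtains H where "\<And>x. (H has_real_derivative f x) (at x)"
proof -
  define H where "H = (\<lambda>u. LBINT y=ereal 0..ereal u. f y)"
  have "(H has_real_derivative f x) (at x)" for x
  proof -
    let ?a = "- \<bar>x\<bar> - 1" and ?b = "\<bar>x\<bar> + 1"
    have mem: "?a \<le> 0" "0 \<le> ?b" "?a \<le> x" "x \<le> ?b" "?a < x" "x < ?b" by linarith+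
    have "continuous_on {?a..?b} f" by (rule continuous_on_subset[OF assms]) simp
    from interval_integral_FTC2[OF mem(1,2) this mem(3,4)]
    have "(H has_vector_derivative f x) (at x within {?a..?b})"
      unfolding H_def .
    then have "(H has_vector_derivative f x) (at x)"
      unfolding at_within_Icc_at[OF mem(5,6)] .
    then show ?thesis by (simp only: has_real_derivative_iff_has_vector_derivative)
  qed
  then show ?thesis using that by blast
qed

section \<open>Half-chords of the unit circle tangent to an inner ellipse\<close>

text \<open>The line \<open>x cos s + y sin s = c\<close> is tangent to \<open>x\<^sup>2 / a + y\<^sup>2 / b = 1\<close> when \<open>c\<^sup>2\<close> has this value
(the squared support function of the ellipse).\<close>

definition tangent_gap :: "real \<Rightarrow> real \<Rightarrow> real \<Rightarrow> real" where
  "tangent_gap a b s = a * (cos s)\<^sup>2 + b * (sin s)\<^sup>2"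

text \<open>On the unit circle the line with normal direction \<open>s\<close> at distance \<open>cos d\<close> from the origin cuts the
chord between the angles \<open>s - d\<close> and \<open>s + d\<close>.\<close>

definition half_chord :: "real \<Rightarrow> real \<Rightarrow> real \<Rightarrow> real" where
  "half_chord a b s = arccos (sqrt (tangent_gap a b s))"

lemma weight_pos:
  assumes "0 < k1" "0 < k2"
  shows "0 < k1 * (cos \<theta>)\<^sup>2 + k2 * (sin (\<theta>::real))\<^sup>2"
proof (cases "cos \<theta> = 0")
  case True
  then have "(sin \<theta>)\<^sup>2 = 1" using sin_cos_squared_add[of \<theta>] by simp
  then show ?thesis using True assms by simp
qed (use assms in \<open>simp add: add_pos_nonneg\<close>)

locale inner_ellipse =
  fixes a b :: real
  assumes ab: "0 < a" "a < b" "b < 1"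
begin

lemma gap_bounds: "0 < tangent_gap a b s" "tangent_gap a b s < 1"
proof -
  have "tangent_gap a b s = a + (b - a) * (sin s)\<^sup>2" "tangent_gap a b s = b - (b - a) * (cos s)\<^sup>2"
    using sin_cos_squared_add[of s] unfolding tangent_gap_def by algebra+
  moreover have "0 \<le> (b - a) * (sin s)\<^sup>2" "0 \<le> (b - a) * (cos s)\<^sup>2" using ab by simp_all
  ultimately show "0 < tangent_gap a b s" "tangent_gap a b s < 1" using ab by linarith+
qed

lemma sqrt_gap_bounds: "0 < sqrt (tangent_gap a b s)" "sqrt (tangent_gap a b s) < 1"
  using gap_bounds[of s] by simp_all

lemma half_chord_bounds: "0 < half_chord a b s" "half_chord a b s < pi / 2"
  using arccos_less_arccos[of "sqrt (tangent_gap a b s)" 1]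
    arccos_less_arccos[of 0 "sqrt (tangent_gap a b s)"] sqrt_gap_bounds[of s]
  unfolding half_chord_def by simp_all

lemma cos_half_chord: "cos (half_chord a b s) = sqrt (tangent_gap a b s)"
  unfolding half_chord_def using sqrt_gap_bounds[of s]
  by (intro cos_arccos) linarith+

lemma cos_half_chord_squared: "(cos (half_chord a b s))\<^sup>2 = tangent_gap a b s"
  using gap_bounds[of s] by (simp add: cos_half_chord)

lemma sin_cos_half_chord_pos: "0 < sin (half_chord a b s)" "0 < cos (half_chord a b s)"
  using half_chord_bounds[of s] by (auto intro!: sin_gt_zero cos_gt_zero_pi)

lemma half_chord_unique:
  assumes "0 \<le> d" "d \<le> pi" "0 \<le> cos d" "(cos d)\<^sup>2 = tangent_gap a b s"
  shows "d = half_chord a b s"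
  using assms unfolding half_chord_def
  by (metis arccos_cos real_sqrt_unique)

lemma half_chord_add_pi: "half_chord a b (s + pi) = half_chord a b s"
  by (simp add: half_chord_def tangent_gap_def)

lemma half_chord_derivative:
  "(half_chord a b has_real_derivative
     - ((b - a) * sin s * cos s) / (sin (half_chord a b s) * cos (half_chord a b s))) (at s)"
proof -
  let ?X = "tangent_gap a b s"
  have X: "0 < ?X" "?X < 1" by (rule gap_bounds)+
  have s1: "sin (half_chord a b s) = sqrt (1 - ?X)"
    using sin_cos_half_chord_pos[of s] cos_half_chord_squared[of s]
    by (metis abs_of_pos real_sqrt_abs sin_squared_eq)
  have "(tangent_gap a b has_real_derivative 2 * ((b - a) * sin s * cos s)) (at s)"
    unfolding tangent_gap_def
    by (auto intro!: derivative_eq_intros simp: algebra_simps)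
  then have "((\<lambda>s. sqrt (tangent_gap a b s)) has_real_derivative
        (inverse (sqrt ?X) / 2) * (2 * ((b - a) * sin s * cos s))) (at s)"
    by (rule DERIV_chain2[where f = sqrt and g = "tangent_gap a b", OF DERIV_real_sqrt[OF X(1)]])
  then have "((\<lambda>s. arccos (sqrt (tangent_gap a b s))) has_real_derivative
        inverse (- sqrt (1 - (sqrt ?X)\<^sup>2)) * ((inverse (sqrt ?X) / 2) * (2 * ((b - a) * sin s * cos s)))) (at s)"
    using sqrt_gap_bounds[of s]
    by (intro DERIV_chain2[where f = arccos and g = "\<lambda>s. sqrt (tangent_gap a b s)", OF DERIV_arccos]) linarith+
  moreover have "inverse (- sqrt (1 - (sqrt ?X)\<^sup>2)) * ((inverse (sqrt ?X) / 2) * (2 * ((b - a) * sin s * cos s)))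
      = - ((b - a) * sin s * cos s) / (sin (half_chord a b s) * cos (half_chord a b s))"
    using X by (simp add: s1 cos_half_chord field_simps)
  ultimately show ?thesis unfolding half_chord_def[abs_def] by (simp add: half_chord_def)
qed

text \<open>Measured along the chord from its midpoint, the endpoints sit at \<open>\<mp> sin d\<close> and the tangency point at
\<open>(b - a) sin s cos s / cos d\<close>; the inequality says that the inner ellipse touches the chord strictly
between its endpoints. Equivalently, both endpoints move forward as \<open>s\<close> increases.\<close>

lemma touching_point_between:
  "\<bar>(b - a) * sin s * cos s\<bar> < sin (half_chord a b s) * cos (half_chord a b s)"
proof -
  let ?C = "(cos s)\<^sup>2" and ?S = "(sin s)\<^sup>2" and ?X = "tangent_gap a b s"
  have C: "?C = 1 - ?S" by (simp add: cos_squared_eq)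
  have S: "0 \<le> ?S" "?S \<le> 1" by (simp_all add: abs_square_le_1)
  have "(sin (half_chord a b s) * cos (half_chord a b s))\<^sup>2 = (1 - ?X) * ?X"
    by (simp add: power_mult_distrib cos_half_chord_squared sin_squared_eq)
  moreover have "((b - a) * sin s * cos s)\<^sup>2 = (b - a)\<^sup>2 * ?S * (1 - ?S)"
    by (simp add: power_mult_distrib cos_squared_eq)
  moreover have "(1 - ?X) * ?X - (b - a)\<^sup>2 * ?S * (1 - ?S) = a * (1 - a) * (1 - ?S) + b * (1 - b) * ?S"
    unfolding tangent_gap_def C by algebra
  moreover have "a * (1 - a) * (1 - ?S) + b * (1 - b) * ?S > 0"
  proof (cases "?S = 0")
    case False
    then have "b * (1 - b) * ?S > 0" using ab S by simp
    moreover have "a * (1 - a) * (1 - ?S) \<ge> 0" using ab S by simp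
    ultimately show ?thesis by simp
  qed (use ab in simp)
  ultimately have "\<bar>(b - a) * sin s * cos s\<bar>\<^sup>2 < (sin (half_chord a b s) * cos (half_chord a b s))\<^sup>2"
    by simp
  then show ?thesis
    by (rule power2_less_imp_less) (use sin_cos_half_chord_pos[of s] in simp)
qed

text \<open>The identity behind the invariant measure. The left-hand side is, up to a constant, the quadratic form of the
second conic at an endpoint of the chord; the base of the square on the right is
\<open>sin d cos d\<close> times the velocity of that endpoint.\<close>

lemma chord_endpoint_weight:
  assumes e: "e = 1 \<or> e = - 1"
  shows "(1 - a) * b * (cos (s + e * half_chord a b s))\<^sup>2 + (1 - b) * a * (sin (s + e * half_chord a b s))\<^sup>2
    = (sin (half_chord a b s) * cos (half_chord a b s) - e * ((b - a) * sin s * cos s))\<^sup>2"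
proof -
  let ?d = "half_chord a b s"
  have e2: "cos (e * ?d) = cos ?d" "sin (e * ?d) = e * sin ?d" "e\<^sup>2 = 1" using e by auto
  have expand: "(1 - a) * b * (x * u - y * (e * v))\<^sup>2 + (1 - b) * a * (y * u + x * (e * v))\<^sup>2
      - (v * u - e * ((b - a) * y * x))\<^sup>2
      = ((1 - a) * b * x\<^sup>2 + (1 - b) * a * y\<^sup>2) * u\<^sup>2
        + ((1 - a) * b * y\<^sup>2 + (1 - b) * a * x\<^sup>2) * (e\<^sup>2 * v\<^sup>2) - v\<^sup>2 * u\<^sup>2 - e\<^sup>2 * (b - a)\<^sup>2 * y\<^sup>2 * x\<^sup>2"
    for x y u v :: real
    by algebra
  have reduce: "((1 - a) * b * c + (1 - b) * a * (1 - c)) * X + ((1 - a) * b * (1 - c) + (1 - b) * a * c) * (1 - X)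
      - (1 - X) * X - (b - a)\<^sup>2 * (1 - c) * c = 0" if "X = a * c + b * (1 - c)" for c X :: real
    unfolding that by algebra
  have trig: "(cos ?d)\<^sup>2 = a * (cos s)\<^sup>2 + b * (1 - (cos s)\<^sup>2)"
      "(sin ?d)\<^sup>2 = 1 - (cos ?d)\<^sup>2" "(sin s)\<^sup>2 = 1 - (cos s)\<^sup>2"
    by (simp_all add: cos_half_chord_squared tangent_gap_def sin_squared_eq)
  show ?thesis
    unfolding cos_add sin_add e2(1,2)
    using expand[of "cos s" "cos ?d" "sin s" "sin ?d"] reduce[OF trig(1)] unfolding trig(2,3) e2(3)
    by (simp add: mult.assoc)
qed

text \<open>The denominator does not depend on the choice of the endpoint. This is why the two velocities cancel
in \<open>chord_measure_constant\<close>.\<close>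

lemma chord_endpoint_derivative:
  assumes e: "e = 1 \<or> e = - 1"
  shows "((\<lambda>s. s + e * half_chord a b s) has_real_derivative
    sqrt ((1 - a) * b * (cos (s + e * half_chord a b s))\<^sup>2 + (1 - b) * a * (sin (s + e * half_chord a b s))\<^sup>2)
    / (sin (half_chord a b s) * cos (half_chord a b s))) (at s)" (is "(_ has_real_derivative ?R) _")
proof -
  let ?p = "sin (half_chord a b s) * cos (half_chord a b s)" and ?q = "(b - a) * sin s * cos s"
  have p: "?p > 0" using sin_cos_half_chord_pos[of s] by simp
  have "?p - e * ?q > 0" using touching_point_between[of s] e by auto
  then have "?R = (?p - e * ?q) / ?p" using chord_endpoint_weight[OF e, of s] by simp
  also have "\<dots> = 1 + e * (- ?q / ?p)" using p less_imp_neq[OF p] by (simp only: diff_divide_distrib) simp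
  finally have R: "?R = 1 + e * (- ?q / ?p)" .
  show ?thesis unfolding R
    by (auto intro!: derivative_eq_intros half_chord_derivative)
qed

lemma chord_start_surj: "\<exists>s. s - half_chord a b s = \<theta>"
proof -
  have "surj (\<lambda>s. s - half_chord a b s)"
  proof (rule surj_of_quasiperiodic[of _ pi pi])
    show "continuous_on UNIV (\<lambda>s. s - half_chord a b s)"
      using DERIV_isCont[OF half_chord_derivative]
      by (auto intro!: continuous_intros simp: continuous_on_eq_continuous_at)
  qed (simp_all add: half_chord_add_pi)
  then show ?thesis unfolding surj_def by metis
qed

lemma chord_start_inj:
  assumes "s - half_chord a b s = s' - half_chord a b s'"
  shows "s = s'"
proof -
  let ?f = "\<lambda>s. s - half_chord a b s"
  have "?f x < ?f y" if "x < y" for x y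
  proof (rule DERIV_pos_imp_increasing[OF that])
    fix z
    have "(?f has_real_derivative
       sqrt ((1 - a) * b * (cos (z - half_chord a b z))\<^sup>2 + (1 - b) * a * (sin (z - half_chord a b z))\<^sup>2)
       / (sin (half_chord a b z) * cos (half_chord a b z))) (at z)"
      using chord_endpoint_derivative[of "-1" z] by simp
    moreover have "0 < sqrt ((1 - a) * b * (cos (z - half_chord a b z))\<^sup>2 + (1 - b) * a * (sin (z - half_chord a b z))\<^sup>2)
       / (sin (half_chord a b z) * cos (half_chord a b z))"
      using sin_cos_half_chord_pos[of z] weight_pos[of "(1 - a) * b" "(1 - b) * a" "z - half_chord a b z"] ab
      by simp
    ultimately show "\<exists>d. (?f has_real_derivative d) (at z) \<and> 0 < d" by blast
  qed
  then show ?thesis using assms by (metis linorder_neqE less_irrefl)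
qed

text \<open>The density \<open>1 / w\<close> is invariant: by \<open>chord_endpoint_derivative\<close> both \<open>H (s + d(s))\<close> and
\<open>H (s - d(s))\<close> have the derivative \<open>1 / (sqrt \<kappa> sin d cos d)\<close>. The density involves \<open>a\<close> and \<open>b\<close> only through
the ratio of its coefficients, so one \<open>H\<close> serves a whole family of inner ellipses.\<close>

lemma chord_measure_constant:
  assumes H: "\<And>x. (H has_real_derivative 1 / sqrt (k1 * (cos x)\<^sup>2 + k2 * (sin x)\<^sup>2)) (at x)"
    and k: "0 < \<kappa>" "k1 = \<kappa> * ((1 - a) * b)" "k2 = \<kappa> * ((1 - b) * a)"
  shows "H (s + half_chord a b s) - H (s - half_chord a b s) =
    H (half_chord a b 0) - H (- half_chord a b 0)"
proof -
  let ?W = "\<lambda>x. (1 - a) * b * (cos x)\<^sup>2 + (1 - b) * a * (sin x)\<^sup>2"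
  have w: "sqrt (k1 * (cos x)\<^sup>2 + k2 * (sin x)\<^sup>2) = sqrt \<kappa> * sqrt (?W x)" for x
    unfolding k real_sqrt_mult[symmetric] by (simp add: algebra_simps)
  have Wpos: "0 < ?W x" for x using weight_pos ab by simp
  have der: "((\<lambda>s. H (s + e * half_chord a b s)) has_real_derivative
      1 / (sqrt \<kappa> * (sin (half_chord a b s) * cos (half_chord a b s)))) (at s)"
    if e: "e = 1 \<or> e = - 1" for e s
  proof -
    let ?r = "sqrt (?W (s + e * half_chord a b s))"
    let ?p = "sin (half_chord a b s) * cos (half_chord a b s)"
    have "?r \<noteq> 0" using Wpos[of "s + e * half_chord a b s"] by simp
    then have eq: "1 / (sqrt \<kappa> * ?r) * (?r / ?p) = 1 / (sqrt \<kappa> * ?p)" by simp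
    show ?thesis
      unfolding eq[symmetric] by (rule DERIV_chain2[OF H[unfolded w] chord_endpoint_derivative[OF e]])
  qed
  have "((\<lambda>s. H (s + half_chord a b s) - H (s - half_chord a b s)) has_real_derivative 0) (at x)" for x
    using DERIV_diff[OF der[of 1 x] der[of "-1" x]] by simp
  from DERIV_isconst_all[OF allI[OF this], of s 0] show ?thesis by simp
qed

end

section \<open>A common frame for two quadratic forms\<close>

lemma form_commute:
  fixes C :: "real ^ 'n ^ 'n"
  assumes "transpose C = C"
  shows "x \<bullet> (C *v y) = y \<bullet> (C *v x)"
  by (metis assms dot_lmul_matrix inner_commute transpose_matrix_vector)

text \<open>The upper-left block is the restriction of the form to the vectors at infinity.\<close>

lemma form_pos_at_infinity:
  fixes C :: "real ^ 3 ^ 3"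
  assumes "positive_definite (upper_left C)" "u $ 3 = 0" "u \<noteq> 0"
  shows "u \<bullet> (C *v u) > 0"
proof -
  let ?w = "vector [u $ 1, u $ 2] :: real ^ 2"
  have "?w \<noteq> 0"
    using assms(2,3) by (auto simp: vec_eq_iff forall_2 forall_3)
  then have "?w \<bullet> (upper_left C *v ?w) > 0"
    using assms(1) unfolding positive_definite_def by blast
  then show ?thesis
    using assms(2)
    by (simp add: upper_left_def inner_vec_def matrix_vector_mult_def sum_2 sum_3)
qed

definition columns3 :: "real ^ 3 \<Rightarrow> real ^ 3 \<Rightarrow> real ^ 3 \<Rightarrow> real ^ 3 ^ 3" where
  "columns3 a b c = transpose (vector [a, b, c])"

lemma columns3_mult: "columns3 a b c *v x = x $ 1 *\<^sub>R a + x $ 2 *\<^sub>R b + x $ 3 *\<^sub>R c"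
  by (simp add: columns3_def transpose_def matrix_vector_mult_def sum_3 vec_eq_iff mult.commute)

lemma det_columns3_uminus: "det (columns3 (- a) b c) = - det (columns3 a b c)"
  by (simp add: columns3_def transpose_def det_3)

lemma form_columns3:
  assumes "\<And>x y. x \<bullet> (C *v y) = y \<bullet> (C *v x)"
    and "a \<bullet> (C *v b) = 0" "a \<bullet> (C *v c) = 0" "b \<bullet> (C *v c) = 0"
  shows "(columns3 a b c *v x) \<bullet> (C *v (columns3 a b c *v y)) =
    x $ 1 * y $ 1 * (a \<bullet> (C *v a)) + x $ 2 * y $ 2 * (b \<bullet> (C *v b)) + x $ 3 * y $ 3 * (c \<bullet> (C *v c))"
proof -
  have "b \<bullet> (C *v a) = 0" "c \<bullet> (C *v a) = 0" "c \<bullet> (C *v b) = 0" using assms by metis+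
  then show ?thesis
    unfolding columns3_mult
    by (simp add: assms(2-) matrix_vector_right_distrib matrix_vector_mult_scaleR inner_add_left inner_add_right)
qed

lemma det_form:
  fixes C T :: "real ^ 3 ^ 3"
  assumes "\<And>x y. (T *v x) \<bullet> (C *v (T *v y)) = p * (x $ 1 * y $ 1) + q * (x $ 2 * y $ 2) + r * (x $ 3 * y $ 3)"
  shows "(det T)\<^sup>2 * det C = p * q * r"
proof -
  have "(transpose T ** C ** T) $ i $ j = (T *v axis i 1) \<bullet> (C *v (T *v axis j 1))" for i j
  proof -
    have "(transpose T ** C ** T) $ i $ j = axis i 1 \<bullet> ((transpose T ** C ** T) *v axis j 1)"
      by (simp add: inner_axis' matrix_vector_mult_basis column_def)
    also have "\<dots> = (T *v axis i 1) \<bullet> (C *v (T *v axis j 1))"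
      by (metis dot_lmul_matrix matrix_vector_mul_assoc transpose_matrix_vector transpose_transpose)
    finally show ?thesis .
  qed
  then have "det (transpose T ** C ** T) = p * q * r"
    unfolding det_3 assms by (simp add: axis_def)
  then show ?thesis by (simp add: det_mul det_transpose power2_eq_square mult.commute mult.left_commute)
qed

lemma matrix_inv_inverse:
  fixes C :: "real ^ 'n ^ 'n"
  assumes "det C \<noteq> 0"
  shows "C ** matrix_inv C = mat 1" "matrix_inv C ** C = mat 1"
proof -
  have "\<exists>B. C ** B = mat 1 \<and> B ** C = mat 1"
    using assms unfolding invertible_det_nz[symmetric] invertible_def .
  then have "C ** matrix_inv C = mat 1 \<and> matrix_inv C ** C = mat 1"
    unfolding matrix_inv_def by (rule someI_ex)
  then show "C ** matrix_inv C = mat 1" "matrix_inv C ** C = mat 1" by simp_all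
qed

lemma generalized_eigenvector:
  fixes C1 C2 :: "real ^ 3 ^ 3"
  assumes "det C1 \<noteq> 0" "l \<in> eigenvalues (matrix_inv C1 ** C2)"
  obtains v where "v \<noteq> 0" "C2 *v v = l *\<^sub>R (C1 *v v)"
proof -
  obtain v where v: "v \<noteq> 0" "(matrix_inv C1 ** C2) *v v = l *\<^sub>R v"
    using assms(2) unfolding eigenvalues_def by blast
  have "C1 ** matrix_inv C1 = mat 1"
    by (rule matrix_inv_inverse[OF assms(1)])
  then have "C2 *v v = C1 *v ((matrix_inv C1 ** C2) *v v)"
    by (simp add: matrix_vector_mul_assoc matrix_mul_assoc)
  then show ?thesis using that v by (simp add: matrix_vector_mult_scaleR)
qed

text \<open>Eigenvectors of \<open>C\<^sub>1\<^sup>-\<^sup>1 C\<^sub>2\<close> for distinct eigenvalues are orthogonal for both forms. As \<open>det C\<^sub>1 < 0\<close> and \<open>C\<^sub>1\<close>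
is positive at infinity, exactly one of them is negative for \<open>C\<^sub>1\<close>. It belongs to the smallest
eigenvalue: otherwise a suitable vector in the span of that negative vector and of the third one is null for \<open>C\<^sub>2\<close> but
positive for \<open>C\<^sub>1\<close>, against the inclusion of the ellipses. Changing the signs of the first and of the third
basis vector gives the positivity of \<open>det T\<close> and of \<open>T $ 3 $ 3\<close>, by which the frame preserves orientation
and the upper half of the cone.\<close>

lemma common_frame_exists:
  fixes C1 C2 :: "real ^ 3 ^ 3"
  assumes sym: "transpose C1 = C1" "transpose C2 = C2"
    and pd: "positive_definite (upper_left C1)" and det: "det C1 < 0"
    and ev: "eigenvalues (matrix_inv C1 ** C2) = {l1, l2, l3}"
    and ord: "l1 > l2" "l2 > l3" "l3 > 0"
    and inside: "\<And>u :: real ^ 3. u \<noteq> 0 \<Longrightarrow> u \<bullet> (C2 *v u) = 0 \<Longrightarrow> u \<bullet> (C1 *v u) < 0"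
  obtains T :: "real ^ 3 ^ 3"
  where "\<And>x y. (T *v x) \<bullet> (C1 *v (T *v y)) = x $ 1 * y $ 1 + x $ 2 * y $ 2 - x $ 3 * y $ 3"
    and "\<And>x y. (T *v x) \<bullet> (C2 *v (T *v y)) = l1 * (x $ 1 * y $ 1) + l2 * (x $ 2 * y $ 2) - l3 * (x $ 3 * y $ 3)"
    and "det T > 0" and "T $ 3 $ 3 > 0"
proof -
  note sym1 = form_commute[OF sym(1)] and sym2 = form_commute[OF sym(2)]
  obtain v1 where v1: "v1 \<noteq> 0" "C2 *v v1 = l1 *\<^sub>R (C1 *v v1)"
    using generalized_eigenvector[of C1 l1 C2] det ev by auto
  obtain v2 where v2: "v2 \<noteq> 0" "C2 *v v2 = l2 *\<^sub>R (C1 *v v2)"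
    using generalized_eigenvector[of C1 l2 C2] det ev by auto
  obtain v3 where v3: "v3 \<noteq> 0" "C2 *v v3 = l3 *\<^sub>R (C1 *v v3)"
    using generalized_eigenvector[of C1 l3 C2] det ev by auto
  have orth: "v \<bullet> (C1 *v w) = 0"
    if "C2 *v v = l *\<^sub>R (C1 *v v)" "C2 *v w = m *\<^sub>R (C1 *v w)" "l \<noteq> m" for v w l m
  proof -
    have "m * (v \<bullet> (C1 *v w)) = l * (v \<bullet> (C1 *v w))"
      using sym2[of v w] sym1[of v w] that(1,2) by simp
    then show ?thesis using that(3) by simp
  qed
  have o1: "v1 \<bullet> (C1 *v v2) = 0" "v1 \<bullet> (C1 *v v3) = 0" "v2 \<bullet> (C1 *v v3) = 0"
    using orth[OF v1(2) v2(2)] orth[OF v1(2) v3(2)] orth[OF v2(2) v3(2)] ord by simp_all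
  define e1 e2 e3 where "e1 = v1 \<bullet> (C1 *v v1)" and "e2 = v2 \<bullet> (C1 *v v2)" and "e3 = v3 \<bullet> (C1 *v v3)"
  define V where "V = columns3 v1 v2 v3"
  have V1: "(V *v x) \<bullet> (C1 *v (V *v y)) = e1 * (x $ 1 * y $ 1) + e2 * (x $ 2 * y $ 2) + e3 * (x $ 3 * y $ 3)" for x y
    unfolding V_def e1_def e2_def e3_def using form_columns3[OF sym1 o1, of x y] by (simp add: mult.commute)
  have V2: "(V *v x) \<bullet> (C2 *v (V *v y)) = l1 * e1 * (x $ 1 * y $ 1) + l2 * e2 * (x $ 2 * y $ 2) + l3 * e3 * (x $ 3 * y $ 3)" for x y
    unfolding V_def e1_def e2_def e3_def
    using form_columns3[OF sym2, of v1 v2 v3 x y] o1 v1 v2 v3 by (simp add: mult.commute mult.left_commute)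
  have ker: "x = 0" if "V *v x = 0" for x
  proof -
    have z: "x $ 1 *\<^sub>R v1 + x $ 2 *\<^sub>R v2 + x $ 3 *\<^sub>R v3 = 0" using that by (simp add: V_def columns3_mult)
    define w1 w2 w3 where "w1 = x $ 1 *\<^sub>R (C1 *v v1)" and "w2 = x $ 2 *\<^sub>R (C1 *v v2)" and "w3 = x $ 3 *\<^sub>R (C1 *v v3)"
    have iC: "C1 ** matrix_inv C1 = mat 1" "matrix_inv C1 ** C1 = mat 1"
      using matrix_inv_inverse[of C1] det by simp_all
    have ev: "(C2 ** matrix_inv C1) *v (C1 *v v) = C2 *v v" for v
      using iC by (simp add: matrix_vector_mul_assoc matrix_mul_assoc[symmetric])
    have a: "w1 + w2 + w3 = 0"
      using arg_cong[OF z, of "(*v) C1"] unfolding w1_def w2_def w3_def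
      by (simp add: matrix_vector_right_distrib matrix_vector_mult_scaleR)
    have W: "(C2 ** matrix_inv C1) *v w1 = l1 *\<^sub>R w1" "(C2 ** matrix_inv C1) *v w2 = l2 *\<^sub>R w2"
        "(C2 ** matrix_inv C1) *v w3 = l3 *\<^sub>R w3"
      unfolding w1_def w2_def w3_def by (simp_all add: ev matrix_vector_mult_scaleR v1 v2 v3)
    have b: "l1 *\<^sub>R w1 + l2 *\<^sub>R w2 + l3 *\<^sub>R w3 = 0"
      using arg_cong[OF a, of "(*v) (C2 ** matrix_inv C1)"] by (simp add: matrix_vector_right_distrib W)
    have c: "(l1 * l1) *\<^sub>R w1 + (l2 * l2) *\<^sub>R w2 + (l3 * l3) *\<^sub>R w3 = 0"
      using arg_cong[OF b, of "(*v) (C2 ** matrix_inv C1)"]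
      by (simp add: matrix_vector_right_distrib matrix_vector_mult_scaleR W)
    \<comment> \<open>A Vandermonde system in each coordinate.\<close>
    have w: "w1 = 0 \<and> w2 = 0 \<and> w3 = 0"
    proof -
      have "w1 $ i = 0 \<and> w2 $ i = 0 \<and> w3 $ i = 0" for i
      proof -
        have *: "w1 $ i + w2 $ i + w3 $ i = 0" "l1 * w1 $ i + l2 * w2 $ i + l3 * w3 $ i = 0"
          "l1 * l1 * w1 $ i + l2 * l2 * w2 $ i + l3 * l3 * w3 $ i = 0"
          using arg_cong[OF a, of "\<lambda>v. v $ i"] arg_cong[OF b, of "\<lambda>v. v $ i"] arg_cong[OF c, of "\<lambda>v. v $ i"]
          by simp_all
        have "(l1 - l2) * (l1 - l3) * w1 $ i = 0" "(l2 - l1) * (l2 - l3) * w2 $ i = 0" "(l3 - l1) * (l3 - l2) * w3 $ i = 0"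
          using * by algebra+
        then show ?thesis using ord by simp
      qed
      then show ?thesis by (simp add: vec_eq_iff)
    qed
    have "C1 *v v \<noteq> 0" if "v \<noteq> 0" for v
      using iC(2) that by (metis matrix_vector_mul_assoc matrix_vector_mul_lid matrix_vector_mult_0_right)
    then have "x $ 1 = 0 \<and> x $ 2 = 0 \<and> x $ 3 = 0"
      using w v1(1) v2(1) v3(1) unfolding w1_def w2_def w3_def by simp
    then show ?thesis by (simp add: vec_eq_iff forall_3)
  qed
  then have "invertible V"
    using matrix_left_invertible_ker invertible_left_inverse by metis
  then have detV: "det V \<noteq> 0" and "surj ((*v) V)"
    by (simp_all add: invertible_det_nz[symmetric] invertible_eq_bij[of V] bij_is_surj)
  then have surjV: "\<exists>x. V *v x = u" for u unfolding surj_def by metis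
  have prod: "e1 * e2 * e3 < 0"
    using det_form[OF V1] detV det by (metis mult_pos_neg zero_less_power2)
  have nonneg_dir: False if "e1 \<le> 0" "e2 \<le> 0" "e3 \<le> 0"
  proof -
    obtain x where x: "V *v x = axis 1 1" using surjV by blast
    have "(axis 1 1 :: real ^ 3) \<noteq> 0" by (simp add: axis_eq_0_iff)
    then have "0 < (V *v x) \<bullet> (C1 *v (V *v x))"
      unfolding x using form_pos_at_infinity[OF pd, of "axis 1 1"] by (simp add: axis_def)
    moreover have "e1 * (x $ 1 * x $ 1) \<le> 0" "e2 * (x $ 2 * x $ 2) \<le> 0" "e3 * (x $ 3 * x $ 3) \<le> 0"
      using that by (simp_all add: mult_nonpos_nonneg)
    ultimately show False unfolding V1 by linarith
  qed
  \<comment> \<open>The weights \<open>sqrt (l3 * e3)\<close> and \<open>sqrt (- (l * e))\<close> make the \<open>C2\<close>-terms of the two directions cancel.\<close>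
  have mixed: False if "e < 0" "e3 > 0" "l > l3" "x $ 3 = sqrt (- (l * e))"
      "(V *v x) \<bullet> (C1 *v (V *v x)) = e * (l3 * e3) + e3 * (x $ 3 * x $ 3)"
      "(V *v x) \<bullet> (C2 *v (V *v x)) = l * e * (l3 * e3) + l3 * e3 * (x $ 3 * x $ 3)" for e l x
  proof -
    have le: "- (l * e) > 0" using that ord by (simp add: mult_pos_neg)
    then have sq: "x $ 3 * x $ 3 = - (l * e)" using that(4) by simp
    have "x \<noteq> 0" using le that(4) by auto
    then have "V *v x \<noteq> 0" using ker by blast
    moreover have "(V *v x) \<bullet> (C2 *v (V *v x)) = 0" unfolding that(6) sq by simp
    ultimately have "(V *v x) \<bullet> (C1 *v (V *v x)) < 0" by (rule inside)
    moreover have "(V *v x) \<bullet> (C1 *v (V *v x)) = (e * e3) * (l3 - l)"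
      unfolding that(5) sq by (simp add: algebra_simps)
    moreover have "(e * e3) * (l3 - l) > 0" using that by (intro mult_neg_neg mult_neg_pos) simp_all
    ultimately show False by simp
  qed
  have e3: "e3 < 0"
  proof (rule ccontr)
    assume "\<not> e3 < 0"
    then have e3: "e3 > 0" using prod by (metis linorder_neqE_linordered_idom mult_zero_right less_irrefl)
    have sq: "sqrt (l3 * e3) * sqrt (l3 * e3) = l3 * e3" using e3 ord by simp
    have "\<not> e1 < 0"
      using mixed[OF _ e3, of e1 l1 "vector [sqrt (l3 * e3), 0, sqrt (- (l1 * e1))]"] ord sq
      by (auto simp: V1 V2)
    moreover have "\<not> e2 < 0"
      using mixed[OF _ e3, of e2 l2 "vector [0, sqrt (l3 * e3), sqrt (- (l2 * e2))]"] ord sq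
      by (auto simp: V1 V2)
    ultimately show False using prod e3 by (metis not_less mult_nonneg_nonneg less_imp_le)
  qed
  have e12: "e1 > 0" "e2 > 0"
  proof -
    have "e1 * e2 > 0" using prod e3 by (simp add: mult_less_0_iff)
    then show "e1 > 0" "e2 > 0" using nonneg_dir e3 by (auto simp: zero_less_mult_iff)
  qed
  have "v3 $ 3 \<noteq> 0" using form_pos_at_infinity[OF pd _ v3(1)] e3 unfolding e3_def by force
  define s where "s = sgn (v3 $ 3)"
  have s: "s * s = 1" "s * v3 $ 3 > 0" using \<open>v3 $ 3 \<noteq> 0\<close> unfolding s_def by (auto simp: sgn_if)
  define a b c where "a = (1 / sqrt e1) *\<^sub>R v1" and "b = (1 / sqrt e2) *\<^sub>R v2" and "c = (s / sqrt (- e3)) *\<^sub>R v3"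
  have g: "a \<bullet> (C1 *v b) = 0" "a \<bullet> (C1 *v c) = 0" "b \<bullet> (C1 *v c) = 0"
      "a \<bullet> (C1 *v a) = 1" "b \<bullet> (C1 *v b) = 1" "c \<bullet> (C1 *v c) = - 1"
    unfolding a_def b_def c_def using e12 e3 o1 s(1)
    by (simp_all add: matrix_vector_mult_scaleR e1_def[symmetric] e2_def[symmetric] e3_def[symmetric] field_simps)
  have C2: "C2 *v a = l1 *\<^sub>R (C1 *v a)" "C2 *v b = l2 *\<^sub>R (C1 *v b)" "C2 *v c = l3 *\<^sub>R (C1 *v c)"
    unfolding a_def b_def c_def by (simp_all add: matrix_vector_mult_scaleR v1 v2 v3)
  have c3: "c $ 3 > 0" using s(2) e3 by (simp add: c_def zero_less_divide_iff)
  have good: "\<And>x y. (columns3 a' b c *v x) \<bullet> (C1 *v (columns3 a' b c *v y)) = x $ 1 * y $ 1 + x $ 2 * y $ 2 - x $ 3 * y $ 3"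
      "\<And>x y. (columns3 a' b c *v x) \<bullet> (C2 *v (columns3 a' b c *v y)) = l1 * (x $ 1 * y $ 1) + l2 * (x $ 2 * y $ 2) - l3 * (x $ 3 * y $ 3)"
      "columns3 a' b c $ 3 $ 3 > 0"
    if "a' = a \<or> a' = - a" for a'
  proof -
    have g': "a' \<bullet> (C1 *v b) = 0" "a' \<bullet> (C1 *v c) = 0" "a' \<bullet> (C1 *v a') = 1" "C2 *v a' = l1 *\<^sub>R (C1 *v a')"
    proof -
      have neg: "C *v (- a) = - (C *v a)" for C :: "real ^ 3 ^ 3"
        using matrix_vector_mult_scaleR[of C "-1" a] by simp
      from that show "a' \<bullet> (C1 *v b) = 0" "a' \<bullet> (C1 *v c) = 0" "a' \<bullet> (C1 *v a') = 1" "C2 *v a' = l1 *\<^sub>R (C1 *v a')"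
        by (elim disjE; simp add: neg g C2)+
    qed
    show "(columns3 a' b c *v x) \<bullet> (C1 *v (columns3 a' b c *v y)) = x $ 1 * y $ 1 + x $ 2 * y $ 2 - x $ 3 * y $ 3" for x y
      using form_columns3[OF sym1 g'(1,2) g(3), of x y] g g' by simp
    show "(columns3 a' b c *v x) \<bullet> (C2 *v (columns3 a' b c *v y)) = l1 * (x $ 1 * y $ 1) + l2 * (x $ 2 * y $ 2) - l3 * (x $ 3 * y $ 3)" for x y
      using form_columns3[OF sym2, of a' b c x y] g g' C2 by simp
    show "columns3 a' b c $ 3 $ 3 > 0" using c3 by (simp add: columns3_def transpose_def)
  qed
  have "(det (columns3 a b c))\<^sup>2 * det C1 = 1 * 1 * (- 1)"
    by (rule det_form) (simp add: good)
  then have "det (columns3 a b c) \<noteq> 0" by auto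
  then have "det (columns3 a b c) > 0 \<or> det (columns3 (- a) b c) > 0"
    unfolding det_columns3_uminus by linarith
  then obtain a' where "a' = a \<or> a' = - a" "det (columns3 a' b c) > 0" by blast
  then show ?thesis using that[OF good(1,2) _ good(3)] by blast
qed

section \<open>The projective image of the unit disc\<close>

definition proj :: "real ^ 3 \<Rightarrow> real \<times> real" where
  "proj u = (u $ 1 / u $ 3, u $ 2 / u $ 3)"

lemma homog_proj: "u $ 3 \<noteq> 0 \<Longrightarrow> homog (proj u) = (1 / u $ 3) *\<^sub>R u"
  by (simp add: homog_def proj_def vec_eq_iff forall_3)

lemma proj_homog: "proj (homog p) = p"
  by (simp add: homog_def proj_def)

lemma proj_scaleR: "r \<noteq> 0 \<Longrightarrow> proj (r *\<^sub>R u) = proj u"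
  by (simp add: proj_def)

lemma homog_affine: "homog ((1 - u) *\<^sub>R p + u *\<^sub>R q) = (1 - u) *\<^sub>R homog p + u *\<^sub>R homog q"
  by (simp add: homog_def vec_eq_iff forall_3)

lemma cross2_eq_triple: "cross2 (p1 - p0) (q - p0) = homog q \<bullet> cross3 (homog p0) (homog p1)"
  by (simp add: cross2_def homog_def cross3_def inner_vec_def sum_3 algebra_simps)

definition circ :: "real \<Rightarrow> real ^ 3" where
  "circ \<theta> = vector [cos \<theta>, sin \<theta>, 1]"

lemma circ_nth [simp]: "circ \<theta> $ 1 = cos \<theta>" "circ \<theta> $ 2 = sin \<theta>" "circ \<theta> $ 3 = 1"
  by (simp_all add: circ_def)

lemma circ_eq_iff: "circ \<theta> = circ \<theta>' \<longleftrightarrow> (\<exists>k::int. \<theta> = \<theta>' + 2 * pi * of_int k)"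
  unfolding sin_cos_eq_iff[symmetric] by (auto simp: vec_eq_iff forall_3)

text \<open>The cross product of two points of the circle is the line through them. For \<open>z $ 3 = 1\<close> the last factor is
the signed distance of \<open>z\<close> from that line, positive on its left when \<open>0 < d < \<pi>\<close>.\<close>

lemma chord_triple:
  "z \<bullet> cross3 (circ (s - d)) (circ (s + d)) = 2 * sin d * (z $ 3 * cos d - z $ 1 * cos s - z $ 2 * sin s)"
proof -
  have "cos (s - d) * sin (s + d) - sin (s - d) * cos (s + d) = sin ((s + d) - (s - d))"
    unfolding sin_diff[of "s + d" "s - d"] by simp
  then have "cos (s - d) * sin (s + d) - sin (s - d) * cos (s + d) = 2 * sin d * cos d"
    by (simp add: sin_double)
  then have "cross3 (circ (s - d)) (circ (s + d)) =
      vector [- (2 * sin d * cos s), - (2 * sin d * sin s), 2 * sin d * cos d]"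
    by (simp add: cross3_def cos_add sin_add cos_diff sin_diff vec_eq_iff forall_3)
  then show ?thesis by (simp add: inner_vec_def sum_3 algebra_simps)
qed

text \<open>The vectors over the closed unit disc, in the half-space where the homogeneous coordinate is positive.\<close>

definition cone :: "(real ^ 3) set" where
  "cone = {x. x $ 3 > 0 \<and> (x $ 1)\<^sup>2 + (x $ 2)\<^sup>2 \<le> (x $ 3)\<^sup>2}"

lemma circ_in_cone: "circ \<theta> \<in> cone"
  by (simp add: cone_def)

text \<open>The matrix \<open>T\<close> carries the unit circle to the outer ellipse.\<close>

locale poncelet_frame =
  fixes C1 C2 T :: "real ^ 3 ^ 3" and l1 l2 l3 :: real
  assumes form1: "(T *v x) \<bullet> (C1 *v (T *v y)) = x $ 1 * y $ 1 + x $ 2 * y $ 2 - x $ 3 * y $ 3"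
    and form2: "(T *v x) \<bullet> (C2 *v (T *v y)) = l1 * (x $ 1 * y $ 1) + l2 * (x $ 2 * y $ 2) - l3 * (x $ 3 * y $ 3)"
    and det_pos: "det T > 0" and height_axis: "T $ 3 $ 3 > 0"
    and ord: "l1 > l2" "l2 > l3"
    and sym: "transpose C1 = C1"
    and posdef: "positive_definite (upper_left C1)"
begin

lemma T_inj: "T *v x = T *v y \<Longrightarrow> x = y" and T_surj: "\<exists>x. u = T *v x"
proof -
  have "bij ((*v) T)" using det_pos by (simp add: invertible_eq_bij[symmetric] invertible_det_nz)
  then show "T *v x = T *v y \<Longrightarrow> x = y" "\<exists>x. u = T *v x"
    unfolding bij_def surj_def inj_def by blast+
qed

lemma height: "(T *v x) $ 3 = T $ 3 $ 1 * x $ 1 + T $ 3 $ 2 * x $ 2 + T $ 3 $ 3 * x $ 3"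
  by (simp add: matrix_vector_mult_def sum_3)

text \<open>The line that \<open>T\<close> sends to infinity misses the closed disc, because \<open>C\<^sub>1\<close> is positive at infinity and
nonpositive on the image of the cone. So the projective change of coordinates is defined on the whole disc.\<close>

lemma height_pos:
  assumes "x \<in> cone"
  shows "(T *v x) $ 3 > 0"
proof -
  let ?p = "T $ 3 $ 1" and ?q = "T $ 3 $ 2" and ?r = "T $ 3 $ 3"
  have x: "x $ 3 > 0" "(x $ 1)\<^sup>2 + (x $ 2)\<^sup>2 \<le> (x $ 3)\<^sup>2" using assms by (simp_all add: cone_def)
  have pq: "?p\<^sup>2 + ?q\<^sup>2 < ?r\<^sup>2"
  proof (rule ccontr)
    assume "\<not> ?p\<^sup>2 + ?q\<^sup>2 < ?r\<^sup>2"
    then have ge: "?r\<^sup>2 \<le> ?p\<^sup>2 + ?q\<^sup>2" by simp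
    \<comment> \<open>If the vanishing line of the height met the disc, its point nearest to the origin, \<open>y\<close>, would be a point of the disc sent to infinity.\<close>
    define y :: "real ^ 3" where "y = vector [- ?p * ?r, - ?q * ?r, ?p\<^sup>2 + ?q\<^sup>2]"
    have r2: "0 < ?r\<^sup>2" using height_axis by simp
    then have y3: "y $ 3 > 0" using less_le_trans[OF r2 ge] by (simp add: y_def)
    then have "y \<noteq> 0" by auto
    then have "T *v y \<noteq> 0" using T_inj[of y 0] by auto
    moreover have "(T *v y) $ 3 = 0" unfolding height y_def by (simp add: power2_eq_square algebra_simps)
    ultimately have "0 < (T *v y) \<bullet> (C1 *v (T *v y))" using form_pos_at_infinity[OF posdef] by blast
    also have "\<dots> = (?p\<^sup>2 + ?q\<^sup>2) * (?r\<^sup>2 - (?p\<^sup>2 + ?q\<^sup>2))"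
      unfolding form1 y_def by (simp add: power2_eq_square algebra_simps)
    also have "\<dots> \<le> 0" using ge by (intro mult_nonneg_nonpos) simp_all
    finally show False by simp
  qed
  have "(?p * x $ 1 + ?q * x $ 2)\<^sup>2 \<le> (?p\<^sup>2 + ?q\<^sup>2) * ((x $ 1)\<^sup>2 + (x $ 2)\<^sup>2)"
  proof -
    have "(?p\<^sup>2 + ?q\<^sup>2) * ((x $ 1)\<^sup>2 + (x $ 2)\<^sup>2) - (?p * x $ 1 + ?q * x $ 2)\<^sup>2 = (?p * x $ 2 - ?q * x $ 1)\<^sup>2"
      by algebra
    then show ?thesis by (metis diff_ge_0_iff_ge zero_le_power2)
  qed
  also have "\<dots> \<le> (?p\<^sup>2 + ?q\<^sup>2) * (x $ 3)\<^sup>2" using x by (intro mult_left_mono) simp_all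
  also have "\<dots> < ?r\<^sup>2 * (x $ 3)\<^sup>2" using pq x by simp
  finally have "\<bar>?p * x $ 1 + ?q * x $ 2\<bar>\<^sup>2 < (?r * x $ 3)\<^sup>2" by (simp add: power_mult_distrib)
  then have "\<bar>?p * x $ 1 + ?q * x $ 2\<bar> < ?r * x $ 3"
    by (rule power2_less_imp_less) (use height_axis x in simp)
  then show ?thesis unfolding height by linarith
qed

definition pt :: "real ^ 3 \<Rightarrow> real \<times> real" where
  "pt x = proj (T *v x)"

lemma homog_pt: "x \<in> cone \<Longrightarrow> homog (pt x) = (1 / (T *v x) $ 3) *\<^sub>R (T *v x)"
  unfolding pt_def using height_pos homog_proj by fastforce

lemma form_pt:
  assumes "x \<in> cone" "y \<in> cone"
  shows "homog (pt x) \<bullet> (C *v homog (pt y)) = (T *v x) \<bullet> (C *v (T *v y)) / ((T *v x) $ 3 * (T *v y) $ 3)"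
  using assms by (simp add: homog_pt matrix_vector_mult_scaleR)

lemma cross2_pt:
  assumes "x \<in> cone" "y \<in> cone" "z \<in> cone"
  shows "cross2 (pt y - pt x) (pt z - pt x) =
    det T * (z \<bullet> cross3 x y) / ((T *v x) $ 3 * (T *v y) $ 3 * (T *v z) $ 3)"
proof -
  have "(T *v z) \<bullet> cross3 (T *v x) (T *v y) = det T * (z \<bullet> cross3 x y)"
  proof -
    have "(T *v z) \<bullet> cross3 (T *v x) (T *v y) = z \<bullet> (transpose T *v cross3 (T *v x) (T *v y))"
      unfolding transpose_matrix_vector by (metis dot_lmul_matrix inner_commute)
    then show ?thesis unfolding cross_matrix_mult by simp
  qed
  then show ?thesis
    unfolding cross2_eq_triple using assms
    by (simp add: homog_pt cross_mult_left cross_mult_right)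
qed

text \<open>The projective change of coordinates preserves the sides of every line through two points of the disc.\<close>

lemma cross2_pt_sign:
  assumes "x \<in> cone" "y \<in> cone" "z \<in> cone"
  shows "cross2 (pt y - pt x) (pt z - pt x) \<ge> 0 \<longleftrightarrow> z \<bullet> cross3 x y \<ge> 0"
    "cross2 (pt y - pt x) (pt z - pt x) > 0 \<longleftrightarrow> z \<bullet> cross3 x y > 0"
proof -
  have "(T *v x) $ 3 * (T *v y) $ 3 * (T *v z) $ 3 > 0" using assms by (simp add: height_pos)
  then show "cross2 (pt y - pt x) (pt z - pt x) \<ge> 0 \<longleftrightarrow> z \<bullet> cross3 x y \<ge> 0"
    "cross2 (pt y - pt x) (pt z - pt x) > 0 \<longleftrightarrow> z \<bullet> cross3 x y > 0"
    using det_pos unfolding cross2_pt[OF assms]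
    by (simp_all add: pos_le_divide_eq pos_less_divide_eq zero_le_mult_iff zero_less_mult_iff)
qed

lemma point_in_cone:
  assumes "homog p \<bullet> (C1 *v homog p) \<le> 0"
  obtains x where "x \<in> cone" "x $ 3 = 1" "p = pt x"
proof -
  obtain x where x: "homog p = T *v x" using T_surj by blast
  have h1: "(T *v x) $ 3 = 1" unfolding x[symmetric] by (simp add: homog_def)
  have le: "(x $ 1)\<^sup>2 + (x $ 2)\<^sup>2 \<le> (x $ 3)\<^sup>2"
    using assms unfolding x form1 by (simp add: power2_eq_square)
  have "x $ 3 \<noteq> 0"
  proof
    assume "x $ 3 = 0"
    with le have "x $ 1 = 0 \<and> x $ 2 = 0" by (simp add: sum_power2_le_zero_iff)
    with \<open>x $ 3 = 0\<close> h1 show False unfolding height by simp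
  qed
  define y where "y = (1 / x $ 3) *\<^sub>R x"
  have "y $ 3 = 1" using \<open>x $ 3 \<noteq> 0\<close> by (simp add: y_def)
  moreover have "y \<in> cone"
  proof -
    have "((x $ 1)\<^sup>2 + (x $ 2)\<^sup>2) / (x $ 3)\<^sup>2 \<le> 1" using le \<open>x $ 3 \<noteq> 0\<close> by simp
    then show ?thesis
      using \<open>x $ 3 \<noteq> 0\<close> by (simp add: cone_def y_def power_divide add_divide_distrib)
  qed
  moreover have "p = pt y"
    unfolding pt_def y_def matrix_vector_mult_scaleR
    using \<open>x $ 3 \<noteq> 0\<close> by (simp add: proj_scaleR x[symmetric] proj_homog)
  ultimately show ?thesis using that by blast
qed

lemma pt_inj:
  assumes "x \<in> cone" "y \<in> cone" "x $ 3 = 1" "y $ 3 = 1" "pt x = pt y"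
  shows "x = y"
proof -
  have "T *v ((1 / (T *v x) $ 3) *\<^sub>R x) = T *v ((1 / (T *v y) $ 3) *\<^sub>R y)"
    unfolding matrix_vector_mult_scaleR homog_pt[OF assms(1), symmetric] homog_pt[OF assms(2), symmetric]
    by (simp only: assms(5))
  then have eq: "(1 / (T *v x) $ 3) *\<^sub>R x = (1 / (T *v y) $ 3) *\<^sub>R y" by (rule T_inj)
  from arg_cong[OF eq, of "\<lambda>v. v $ 3"] have "1 / (T *v x) $ 3 = 1 / (T *v y) $ 3" using assms by simp
  then show ?thesis using eq height_pos[OF assms(1)] height_pos[OF assms(2)] by simp
qed

definition \<psi> :: "real \<Rightarrow> real \<times> real" where "\<psi> \<theta> = pt (circ \<theta>)"

lemma \<psi>_eq_iff: "\<psi> \<theta> = \<psi> \<theta>' \<longleftrightarrow> (\<exists>k::int. \<theta> = \<theta>' + 2 * pi * of_int k)"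
  unfolding circ_eq_iff[symmetric] \<psi>_def
  using pt_inj[OF circ_in_cone circ_in_cone circ_nth(3) circ_nth(3)] by auto

lemma conic1_eq_range: "conic_curve C1 = range \<psi>"
proof
  show "range \<psi> \<subseteq> conic_curve C1"
  proof
    fix p assume "p \<in> range \<psi>"
    then obtain \<theta> where p: "p = pt (circ \<theta>)" unfolding \<psi>_def by blast
    have "cos \<theta> * cos \<theta> + sin \<theta> * sin \<theta> = 1"
      using sin_cos_squared_add2[of \<theta>] by (simp add: power2_eq_square)
    then show "p \<in> conic_curve C1"
      unfolding conic_curve_def p by (simp add: form_pt circ_in_cone form1)
  qed
  show "conic_curve C1 \<subseteq> range \<psi>"
  proof
    fix p assume "p \<in> conic_curve C1"
    then have p0: "homog p \<bullet> (C1 *v homog p) = 0" by (simp add: conic_curve_def)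
    then obtain x where x: "x \<in> cone" "x $ 3 = 1" "p = pt x" using point_in_cone[OF eq_refl[OF p0]] by blast
    have "(T *v x) \<bullet> (C1 *v (T *v x)) = 0"
      using p0 height_pos[OF x(1)] unfolding x(3) by (simp add: form_pt[OF x(1) x(1)])
    then have "(x $ 1)\<^sup>2 + (x $ 2)\<^sup>2 = 1" unfolding form1 x(2) by (simp add: power2_eq_square)
    from sincos_total_2pi[OF this] obtain \<theta> where "x $ 1 = cos \<theta>" "x $ 2 = sin \<theta>" by blast
    then have "x = circ \<theta>" using x(2) by (simp add: vec_eq_iff forall_3)
    then show "p \<in> range \<psi>" using x(3) by (simp add: \<psi>_def)
  qed
qed

lemma closed_segment_pt:
  assumes "x \<in> cone" "y \<in> cone" "z \<in> cone" "z = \<alpha> *\<^sub>R x + \<beta> *\<^sub>R y" "\<alpha> \<ge> 0" "\<beta> \<ge> 0"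
  shows "pt z \<in> closed_segment (pt x) (pt y)"
proof -
  let ?hx = "(T *v x) $ 3" and ?hy = "(T *v y) $ 3" and ?hz = "(T *v z) $ 3"
  have h: "?hx > 0" "?hy > 0" "?hz > 0" using assms height_pos by blast+
  have Tz: "T *v z = \<alpha> *\<^sub>R (T *v x) + \<beta> *\<^sub>R (T *v y)"
    unfolding assms(4) by (simp add: matrix_vector_right_distrib matrix_vector_mult_scaleR)
  have hz: "?hz = \<alpha> * ?hx + \<beta> * ?hy" unfolding Tz by simp
  define u where "u = \<beta> * ?hy / ?hz"
  have u: "0 \<le> u" "u \<le> 1" "1 - u = \<alpha> * ?hx / ?hz"
    using h assms(5,6) unfolding u_def by (simp_all add: divide_le_eq hz diff_divide_distrib add_divide_distrib field_simps)
  have "(1 - u) *\<^sub>R ((1 / ?hx) *\<^sub>R (T *v x)) + u *\<^sub>R ((1 / ?hy) *\<^sub>R (T *v y)) = (1 / ?hz) *\<^sub>R (T *v z)"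
  proof -
    have "(\<alpha> * p / r) *\<^sub>R ((1 / p) *\<^sub>R v) + (\<beta> * q / r) *\<^sub>R ((1 / q) *\<^sub>R w) = (1 / r) *\<^sub>R (\<alpha> *\<^sub>R v + \<beta> *\<^sub>R w)"
      if "p > 0" "q > 0" "r > 0" for p q r :: real and v w :: "real ^ 3"
      using that by (simp add: scaleR_add_right)
    from this[OF h, of "T *v x" "T *v y"] show ?thesis unfolding u(3) unfolding u_def Tz[symmetric] .
  qed
  then have "homog ((1 - u) *\<^sub>R pt x + u *\<^sub>R pt y) = homog (pt z)"
    unfolding homog_affine homog_pt[OF assms(1)] homog_pt[OF assms(2)] homog_pt[OF assms(3)] .
  then have "pt z = (1 - u) *\<^sub>R pt x + u *\<^sub>R pt y" by (metis proj_homog)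
  then show ?thesis using u by (auto simp: in_segment)
qed

end

section \<open>The angular parametrisation of the outer ellipse\<close>

text \<open>Over a short interval the increment cannot reach \<open>- \<pi>\<close>, where the sine vanishes, so it stays in \<open>(0, \<pi>)\<close>.
Doubling the length of the interval then covers the whole line.\<close>

lemma strict_mono_of_sin_pos:
  fixes \<alpha> :: "real \<Rightarrow> real"
  assumes cont: "continuous_on UNIV \<alpha>" and \<delta>: "\<delta> > 0"
    and pos: "\<And>x y. x < y \<Longrightarrow> y < x + \<delta> \<Longrightarrow> sin (\<alpha> y - \<alpha> x) > 0"
  shows "strict_mono \<alpha>"
proof -
  have near: "\<alpha> x < \<alpha> y" if xy: "x < y" "y < x + \<delta>" for x y
  proof (rule ccontr)
    assume "\<not> \<alpha> x < \<alpha> y"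
    then have le: "\<alpha> y - \<alpha> x \<le> 0" by simp
    have "\<alpha> y - \<alpha> x < - pi"
    proof (rule ccontr)
      assume "\<not> \<alpha> y - \<alpha> x < - pi"
      then have "0 \<le> sin (- (\<alpha> y - \<alpha> x))" using le by (intro sin_ge_zero) linarith+
      then show False using pos[OF xy] unfolding sin_minus by linarith
    qed
    then have "\<exists>z\<ge>x. z \<le> y \<and> \<alpha> z = \<alpha> x - pi"
      using xy by (intro IVT2') (auto intro: continuous_on_subset[OF cont])
    then obtain z where z: "x \<le> z" "z \<le> y" "\<alpha> z = \<alpha> x - pi" by blast
    then have "x < z" using pi_gt_zero by (cases "z = x") auto
    then have "sin (\<alpha> z - \<alpha> x) > 0" using z xy by (intro pos) simp_all
    then show False using z(3) by simp
  qed
  have "\<alpha> x < \<alpha> y" if "x < y" "y < x + 2 ^ n * \<delta>" for n x y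
    using that
  proof (induction n arbitrary: x y)
    case (Suc n)
    have "\<alpha> x < \<alpha> ((x + y) / 2)" by (rule Suc.IH) (use Suc.prems in \<open>simp_all add: field_simps\<close>)
    also have "\<dots> < \<alpha> y" by (rule Suc.IH) (use Suc.prems in \<open>simp_all add: field_simps\<close>)
    finally show ?case .
  qed (simp add: near)
  moreover have "\<exists>n. y < x + 2 ^ n * \<delta>" for x y
  proof -
    obtain n where "(y - x) / \<delta> < 2 ^ n" using real_arch_pow[of 2] by auto
    then show ?thesis using \<delta> by (intro exI[of _ n]) (simp add: field_simps)
  qed
  ultimately show ?thesis by (intro strict_monoI) metis
qed

context poncelet_frame
begin

lemma sym1: "x \<bullet> (C1 *v y) = y \<bullet> (C1 *v x)"
  by (rule form_commute[OF sym])

lemma infinity_vector_zero: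
  assumes "u $ 3 = 0" "(C1 *v u) $ 1 = 0" "(C1 *v u) $ 2 = 0"
  shows "u = 0"
proof (rule ccontr)
  assume "u \<noteq> 0"
  with form_pos_at_infinity[OF posdef assms(1)] have "u \<bullet> (C1 *v u) > 0" by simp
  then show False using assms by (simp add: inner_vec_def sum_3)
qed

lemma centre_polar: "(C1 *v homog (conic_centre C1)) $ 1 = 0 \<and> (C1 *v homog (conic_centre C1)) $ 2 = 0"
proof -
  let ?a = "C1 $ 1 $ 1" and ?b = "C1 $ 1 $ 2" and ?c = "C1 $ 2 $ 2"
  have "transpose C1 $ 1 $ 2 = C1 $ 2 $ 1" by (simp add: transpose_def)
  then have b: "C1 $ 2 $ 1 = ?b" unfolding sym by simp
  have "0 < ?a * (?a * ?c - ?b * ?b)" if "?a \<noteq> 0"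
  proof -
    let ?u = "vector [- ?b, ?a, 0] :: real ^ 3"
    have "?u \<noteq> 0" using that by (auto simp: vec_eq_iff forall_3)
    from form_pos_at_infinity[OF posdef _ this] show ?thesis
      by (simp add: inner_vec_def matrix_vector_mult_def sum_3 b algebra_simps)
  qed
  moreover have "0 < ?a"
  proof -
    let ?u = "vector [1, 0, 0] :: real ^ 3"
    have "?u \<noteq> 0" by (auto simp: vec_eq_iff forall_3)
    from form_pos_at_infinity[OF posdef _ this] show ?thesis
      by (simp add: inner_vec_def matrix_vector_mult_def sum_3)
  qed
  ultimately have D: "?a * ?c - ?b * ?b \<noteq> 0" by auto
  let ?D = "?a * ?c - ?b * ?b"
  define x where "x = (?b * C1 $ 2 $ 3 - ?c * C1 $ 1 $ 3) / ?D"
  define y where "y = (?b * C1 $ 1 $ 3 - ?a * C1 $ 2 $ 3) / ?D"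
  have xy: "x * ?D = ?b * C1 $ 2 $ 3 - ?c * C1 $ 1 $ 3" "y * ?D = ?b * C1 $ 1 $ 3 - ?a * C1 $ 2 $ 3"
    using D by (simp_all add: x_def y_def)
  have "?D * (?a * x + ?b * y + C1 $ 1 $ 3) = 0" "?D * (?b * x + ?c * y + C1 $ 2 $ 3) = 0"
    using xy by algebra+
  then have "?a * x + ?b * y + C1 $ 1 $ 3 = 0" "?b * x + ?c * y + C1 $ 2 $ 3 = 0"
    using D unfolding mult_eq_0_iff by blast+
  then have p: "(C1 *v homog (x, y)) $ 1 = 0 \<and> (C1 *v homog (x, y)) $ 2 = 0"
    by (simp add: homog_def matrix_vector_mult_def sum_3 b)
  have unique: "q = (x, y)" if "(C1 *v homog q) $ 1 = 0 \<and> (C1 *v homog q) $ 2 = 0" for q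
  proof -
    have "(homog q - homog (x, y)) $ 3 = 0" by (simp add: homog_def)
    then have "homog q - homog (x, y) = 0"
      by (rule infinity_vector_zero) (use p that in \<open>simp_all add: matrix_vector_mult_diff_distrib\<close>)
    then have "proj (homog q) = proj (homog (x, y))" by simp
    then show ?thesis unfolding proj_homog .
  qed
  have "conic_centre C1 = (x, y)"
    unfolding conic_centre_def by (rule the_equality) (fact p, fact unique)
  with p show ?thesis by simp
qed

abbreviation "centre \<equiv> conic_centre C1"

lemma form_centre_infinity: "u $ 3 = 0 \<Longrightarrow> u \<bullet> (C1 *v homog centre) = 0"
  using centre_polar by (simp add: inner_vec_def sum_3)

text \<open>The centre is orthogonal to all vectors at infinity, on which the form is positive; were it nonnegative at the
centre too, it would be nonnegative everywhere.\<close>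

lemma form_centre_neg: "homog centre \<bullet> (C1 *v homog centre) < 0"
proof (rule ccontr)
  assume ge: "\<not> homog centre \<bullet> (C1 *v homog centre) < 0"
  define v where "v = T *v axis 3 1"
  define u where "u = v - (v $ 3) *\<^sub>R homog centre"
  have u3: "u $ 3 = 0" by (simp add: u_def homog_def)
  have v: "u + (v $ 3) *\<^sub>R homog centre = v" by (simp add: u_def)
  have "(u + k *\<^sub>R homog centre) \<bullet> (C1 *v (u + k *\<^sub>R homog centre)) =
      u \<bullet> (C1 *v u) + k\<^sup>2 * (homog centre \<bullet> (C1 *v homog centre))" for k
    using form_centre_infinity[OF u3] sym1[of u "homog centre"]
    by (simp add: matrix_vector_right_distrib matrix_vector_mult_scaleR inner_add_left inner_add_right power2_eq_square)
  from this[of "v $ 3"] have "v \<bullet> (C1 *v v) = u \<bullet> (C1 *v u) + (v $ 3)\<^sup>2 * (homog centre \<bullet> (C1 *v homog centre))"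
    unfolding v .
  moreover have "u \<bullet> (C1 *v u) \<ge> 0"
    using form_pos_at_infinity[OF posdef u3] by (cases "u = 0") (simp_all add: less_imp_le)
  moreover have "v \<bullet> (C1 *v v) = - 1" unfolding v_def form1 by (simp add: axis_def)
  moreover have "(v $ 3)\<^sup>2 * (homog centre \<bullet> (C1 *v homog centre)) \<ge> 0" using ge by simp
  ultimately show False by linarith
qed

text \<open>Along a ray from the centre the form has no linear term, so each ray meets the ellipse exactly once.\<close>

lemma on_ray_iff:
  "centre + r *\<^sub>R (cos \<phi>, sin \<phi>) \<in> conic_curve C1 \<longleftrightarrow>
   r\<^sup>2 * (vector [cos \<phi>, sin \<phi>, 0] \<bullet> (C1 *v vector [cos \<phi>, sin \<phi>, 0])) = - (homog centre \<bullet> (C1 *v homog centre))"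
proof -
  let ?w = "vector [cos \<phi>, sin \<phi>, 0] :: real ^ 3"
  have "homog (centre + r *\<^sub>R (cos \<phi>, sin \<phi>)) = homog centre + r *\<^sub>R ?w"
    by (simp add: homog_def vec_eq_iff forall_3)
  moreover have "?w \<bullet> (C1 *v homog centre) = 0" by (rule form_centre_infinity) simp
  moreover have "homog centre \<bullet> (C1 *v ?w) = 0" using sym1 calculation(2) by metis
  ultimately show ?thesis
    unfolding conic_curve_def
    by (simp add: matrix_vector_right_distrib matrix_vector_mult_scaleR inner_add_left inner_add_right
        power2_eq_square) (simp add: algebra_simps eq_neg_iff_add_eq_0)
qed

lemma ellipse_param_eqI:
  assumes "centre + r *\<^sub>R (cos (2 * pi * t), sin (2 * pi * t)) \<in> conic_curve C1" "r > 0"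
  shows "ellipse_param C1 t = centre + r *\<^sub>R (cos (2 * pi * t), sin (2 * pi * t))"
  unfolding ellipse_param_def
proof (rule the_equality)
  fix z assume "z \<in> conic_curve C1 \<and> (\<exists>r>0. z = centre + r *\<^sub>R (cos (2 * pi * t), sin (2 * pi * t)))"
  then obtain r' where z: "z = centre + r' *\<^sub>R (cos (2 * pi * t), sin (2 * pi * t))" "r' > 0" "z \<in> conic_curve C1"
    by blast
  let ?w = "vector [cos (2 * pi * t), sin (2 * pi * t), 0] :: real ^ 3"
  have "r\<^sup>2 * (?w \<bullet> (C1 *v ?w)) = r'\<^sup>2 * (?w \<bullet> (C1 *v ?w))" "r\<^sup>2 * (?w \<bullet> (C1 *v ?w)) \<noteq> 0"
    using assms(1) z(3) form_centre_neg unfolding z(1) on_ray_iff by simp_all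
  then have "r\<^sup>2 = r'\<^sup>2" by auto
  then have "r = r'" using assms(2) z(2) by (simp add: power2_eq_iff_nonneg)
  then show "z = centre + r *\<^sub>R (cos (2 * pi * t), sin (2 * pi * t))" using z(1) by simp
qed (use assms in blast)

lemma continuous_\<psi>: "continuous_on UNIV \<psi>"
proof -
  have nz: "(T *v circ \<theta>) $ 3 \<noteq> 0" for \<theta> using height_pos[OF circ_in_cone, of \<theta>] by simp
  have coord: "(T *v circ \<theta>) $ i = T $ i $ 1 * cos \<theta> + T $ i $ 2 * sin \<theta> + T $ i $ 3" for i \<theta>
    by (simp add: matrix_vector_mult_def sum_3)
  show ?thesis
    unfolding \<psi>_def pt_def proj_def using nz unfolding coord
    by (intro continuous_intros) auto
qed

text \<open>The centre is an interior point of the disc in the frame, hence lies on the left of every short chord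
of the circle traversed counterclockwise. One \<open>\<delta>\<close> works for all chords because \<open>cos d\<close> only has to exceed the
distance \<open>\<kappa>\<close> of the centre from the origin of the disc.\<close>

lemma circle_image_counterclockwise:
  obtains \<delta> where "\<delta> > 0"
    "\<And>\<theta>0 \<theta>1. \<theta>0 < \<theta>1 \<Longrightarrow> \<theta>1 < \<theta>0 + \<delta> \<Longrightarrow> cross2 (\<psi> \<theta>0 - centre) (\<psi> \<theta>1 - centre) > 0"
proof -
  obtain x where x: "x \<in> cone" "x $ 3 = 1" "centre = pt x"
    using point_in_cone form_centre_neg by (metis less_imp_le)
  define \<kappa> where "\<kappa> = sqrt ((x $ 1)\<^sup>2 + (x $ 2)\<^sup>2)"
  have "(T *v x) \<bullet> (C1 *v (T *v x)) < 0"
    using form_centre_neg height_pos[OF x(1)] unfolding x(3)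
    by (simp add: form_pt[OF x(1) x(1)] divide_less_0_iff)
  then have "(x $ 1)\<^sup>2 + (x $ 2)\<^sup>2 < 1" unfolding form1 x(2) by (simp add: power2_eq_square)
  then have \<kappa>: "0 \<le> \<kappa>" "\<kappa> < 1" by (simp_all add: \<kappa>_def)
  have "arccos 1 < arccos \<kappa>" using \<kappa> by (intro arccos_less_arccos) auto
  moreover have "arccos \<kappa> \<le> arccos 0" using \<kappa> by (intro arccos_le_arccos) auto
  ultimately have ac: "0 < arccos \<kappa>" "arccos \<kappa> \<le> pi / 2" by simp_all
  have "cross2 (\<psi> \<theta>0 - centre) (\<psi> \<theta>1 - centre) > 0" if \<theta>: "\<theta>0 < \<theta>1" "\<theta>1 < \<theta>0 + 2 * arccos \<kappa>" for \<theta>0 \<theta>1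
  proof -
    define s d where "s = (\<theta>0 + \<theta>1) / 2" and "d = (\<theta>1 - \<theta>0) / 2"
    have sd: "\<theta>0 = s - d" "\<theta>1 = s + d" by (simp_all add: s_def d_def field_simps)
    have d: "0 < d" "d < arccos \<kappa>" using \<theta> by (simp_all add: d_def)
    have "cos (arccos \<kappa>) < cos d" using d ac by (intro cos_monotone_0_pi) simp_all
    then have "\<kappa> < cos d" using \<kappa> by (simp add: cos_arccos)
    moreover have "x $ 1 * cos s + x $ 2 * sin s \<le> \<kappa>"
      unfolding \<kappa>_def
    proof (rule real_le_rsqrt)
      have "(x $ 1 * cos s + x $ 2 * sin s)\<^sup>2 + (x $ 1 * sin s - x $ 2 * cos s)\<^sup>2 = (x $ 1)\<^sup>2 + (x $ 2)\<^sup>2"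
        using sin_cos_squared_add[of s] by algebra
      then show "(x $ 1 * cos s + x $ 2 * sin s)\<^sup>2 \<le> (x $ 1)\<^sup>2 + (x $ 2)\<^sup>2"
        by (metis le_add_same_cancel1 zero_le_power2)
    qed
    moreover have "sin d > 0" using d ac by (intro sin_gt_zero) linarith+
    ultimately have "x \<bullet> cross3 (circ \<theta>0) (circ \<theta>1) > 0"
      unfolding sd chord_triple x(2) by simp
    then have "cross2 (\<psi> \<theta>1 - \<psi> \<theta>0) (centre - \<psi> \<theta>0) > 0"
      unfolding \<psi>_def x(3) by (simp add: cross2_pt_sign circ_in_cone x(1))
    then show ?thesis by (simp add: cross2_def algebra_simps)
  qed
  then show ?thesis using that[of "2 * arccos \<kappa>"] ac by simp
qed

text \<open>The angle of \<open>\<psi> \<theta>\<close> seen from the centre is lifted to the line as the imaginary part of a continuous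
logarithm. The lift \<open>\<alpha>\<close> increases, and gains \<open>2\<pi>\<close> per period rather than a higher multiple, as each
ray meets the ellipse only once. Its inverse, rescaled, is the reparametrisation.\<close>

lemma ellipse_param_reparametrizes:
  obtains \<beta> where "continuous_on UNIV \<beta>" "strict_mono \<beta>" "\<And>t. \<beta> (t + 1) = \<beta> t + 2 * pi"
    "\<And>t. ellipse_param C1 t = \<psi> (\<beta> t)"
proof -
  define f where "f \<theta> = Complex (fst (\<psi> \<theta> - centre)) (snd (\<psi> \<theta> - centre))" for \<theta>
  have contf: "continuous_on UNIV f"
    unfolding f_def Complex_eq by (intro continuous_intros continuous_\<psi>)
  have nz: "f \<theta> \<noteq> 0" for \<theta>
  proof
    assume "f \<theta> = 0"
    then have "\<psi> \<theta> = centre" by (simp add: f_def complex_eq_iff prod_eq_iff)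
    moreover have "\<psi> \<theta> \<in> conic_curve C1" by (simp add: conic1_eq_range)
    ultimately show False using form_centre_neg by (simp add: conic_curve_def)
  qed
  obtain g where contg: "continuous_on UNIV g" and fg: "\<And>\<theta>. f \<theta> = exp (g \<theta>)"
    using continuous_logarithm_on_contractible[OF contf] nz
    by (metis UNIV_I convex_UNIV convex_imp_contractible)
  define \<alpha> where "\<alpha> \<theta> = Im (g \<theta>)" for \<theta>
  define r where "r \<theta> = exp (Re (g \<theta>))" for \<theta>
  have cont\<alpha>: "continuous_on UNIV \<alpha>" unfolding \<alpha>_def by (intro continuous_intros contg)
  have polar: "\<psi> \<theta> = centre + r \<theta> *\<^sub>R (cos (\<alpha> \<theta>), sin (\<alpha> \<theta>))" and r: "r \<theta> > 0" for \<theta>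
    using fg[of \<theta>] by (simp_all add: f_def \<alpha>_def r_def complex_eq_iff Re_exp Im_exp prod_eq_iff algebra_simps)
  have param: "ellipse_param C1 (\<alpha> \<theta> / (2 * pi)) = \<psi> \<theta>" for \<theta>
  proof -
    have "centre + r \<theta> *\<^sub>R (cos (2 * pi * (\<alpha> \<theta> / (2 * pi))), sin (2 * pi * (\<alpha> \<theta> / (2 * pi)))) = \<psi> \<theta>"
      using polar[of \<theta>] by simp
    then show ?thesis using ellipse_param_eqI[OF _ r, of \<theta> "\<alpha> \<theta> / (2 * pi)"] conic1_eq_range by simp
  qed
  obtain \<delta> where \<delta>: "\<delta> > 0"
    "\<And>\<theta>0 \<theta>1. \<theta>0 < \<theta>1 \<Longrightarrow> \<theta>1 < \<theta>0 + \<delta> \<Longrightarrow> cross2 (\<psi> \<theta>0 - centre) (\<psi> \<theta>1 - centre) > 0"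
    by (rule circle_image_counterclockwise) (rule that)
  have mono: "strict_mono \<alpha>"
  proof (rule strict_mono_of_sin_pos[OF cont\<alpha> \<delta>(1)])
    fix x y :: real assume "x < y" "y < x + \<delta>"
    then have "cross2 (\<psi> x - centre) (\<psi> y - centre) > 0" by (rule \<delta>(2))
    moreover have "cross2 (\<psi> x - centre) (\<psi> y - centre) = r x * r y * sin (\<alpha> y - \<alpha> x)"
      unfolding polar cross2_def by (simp add: sin_diff algebra_simps)
    ultimately have "0 < r x * r y * sin (\<alpha> y - \<alpha> x)" by simp
    then show "sin (\<alpha> y - \<alpha> x) > 0" by (rule zero_less_mult_pos) (simp add: r)
  qed
  have per\<psi>: "\<psi> (\<theta> + 2 * pi) = \<psi> \<theta>" for \<theta> unfolding \<psi>_eq_iff by (rule exI[of _ 1]) simp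
  have "(\<alpha> (\<theta> + 2 * pi) - \<alpha> \<theta>) / (2 * pi) \<in> \<int>" for \<theta>
  proof -
    have "f (\<theta> + 2 * pi) = f \<theta>" unfolding f_def per\<psi> ..
    then obtain n :: int where "g (\<theta> + 2 * pi) = g \<theta> + (of_int (2 * n) * pi) * \<i>"
      unfolding fg exp_eq by blast
    then have "\<alpha> (\<theta> + 2 * pi) - \<alpha> \<theta> = 2 * of_int n * pi" by (simp add: \<alpha>_def)
    then show ?thesis by simp
  qed
  moreover have "continuous_on UNIV (\<lambda>\<theta>. (\<alpha> (\<theta> + 2 * pi) - \<alpha> \<theta>) / (2 * pi))"
    by (intro continuous_intros continuous_on_compose2[OF cont\<alpha>]) auto
  ultimately obtain k where k: "\<And>\<theta>. (\<alpha> (\<theta> + 2 * pi) - \<alpha> \<theta>) / (2 * pi) = of_int k"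
    using continuous_int_constant by blast
  have k': "\<alpha> (\<theta> + 2 * pi) = \<alpha> \<theta> + 2 * pi * of_int k" for \<theta>
  proof -
    have "\<alpha> (\<theta> + 2 * pi) - \<alpha> \<theta> = 2 * pi * of_int k" unfolding k[of \<theta>, symmetric] by simp
    then show ?thesis by linarith
  qed
  have "\<alpha> 0 < \<alpha> (0 + 2 * pi)" by (rule strict_monoD[OF mono]) simp
  then have "0 < 2 * pi * real_of_int k" unfolding k' by simp
  then have "k > 0" by (simp add: zero_less_mult_iff)
  have "k = 1"
  proof (rule ccontr)
    assume "k \<noteq> 1"
    then have "of_int k \<ge> (2 :: real)" using \<open>k > 0\<close> by linarith
    then have le: "\<alpha> 0 + 2 * pi < \<alpha> (2 * pi)" using k'[of 0] by simp
    then have "\<exists>x\<ge>0. x \<le> 2 * pi \<and> \<alpha> x = \<alpha> 0 + 2 * pi"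
      by (intro IVT') (auto intro: continuous_on_subset[OF cont\<alpha>])
    then obtain x where x: "0 \<le> x" "x \<le> 2 * pi" "\<alpha> x = \<alpha> 0 + 2 * pi" by blast
    have "ellipse_param C1 (\<alpha> x / (2 * pi)) = ellipse_param C1 (\<alpha> 0 / (2 * pi))"
      unfolding ellipse_param_def by (simp add: x(3))
    then have "\<psi> x = \<psi> 0" unfolding param .
    then obtain j :: int where j: "x = 2 * pi * of_int j" unfolding \<psi>_eq_iff by auto
    have "x \<noteq> 0" "x \<noteq> 2 * pi" using x(3) le by auto
    then have "0 < x" "x < 2 * pi" using x by simp_all
    then have "0 < j" "j < 1" unfolding j by (simp_all add: zero_less_mult_iff)
    then show False by simp
  qed
  then have per\<alpha>: "\<alpha> (\<theta> + 2 * pi) = \<alpha> \<theta> + 2 * pi" for \<theta>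
    unfolding k' \<open>k = 1\<close> by simp
  have surj: "surj \<alpha>" by (rule surj_of_quasiperiodic[OF cont\<alpha> _ _ per\<alpha>]) simp_all
  note inv = continuous_strict_mono_inverse[OF mono surj]
  have inv\<alpha>: "\<alpha> (inv \<alpha> y) = y" for y using surj by (simp add: surj_f_inv_f)
  show ?thesis
  proof (rule that[of "\<lambda>t. inv \<alpha> (2 * pi * t)"])
    show "continuous_on UNIV (\<lambda>t. inv \<alpha> (2 * pi * t))"
      by (intro continuous_on_compose2[OF inv(1)] continuous_intros) auto
    show "strict_mono (\<lambda>t. inv \<alpha> (2 * pi * t))"
      by (rule strict_monoI, rule strict_monoD[OF inv(2)]) simp
    show "inv \<alpha> (2 * pi * (t + 1)) = inv \<alpha> (2 * pi * t) + 2 * pi" for t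
    proof -
      have "\<alpha> (inv \<alpha> (2 * pi * (t + 1))) = \<alpha> (inv \<alpha> (2 * pi * t) + 2 * pi)"
        unfolding per\<alpha> inv\<alpha> by (simp add: algebra_simps)
      then show ?thesis using mono by (simp add: strict_mono_eq)
    qed
    show "ellipse_param C1 t = \<psi> (inv \<alpha> (2 * pi * t))" for t
      using param[of "inv \<alpha> (2 * pi * t)"] unfolding inv\<alpha> by simp
  qed
qed

end

section \<open>The Poncelet map in the frame\<close>

context poncelet_frame
begin

lemma form_pencil:
  "(T *v x) \<bullet> (pencil C1 C2 \<nu> *v (T *v y)) =
     (fst \<nu> + l1 * snd \<nu>) * (x $ 1 * y $ 1) + (fst \<nu> + l2 * snd \<nu>) * (x $ 2 * y $ 2)
     - (fst \<nu> + l3 * snd \<nu>) * (x $ 3 * y $ 3)"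
proof -
  have "pencil C1 C2 \<nu> *v v = fst \<nu> *\<^sub>R (C1 *v v) + snd \<nu> *\<^sub>R (C2 *v v)" for v
    by (simp add: pencil_def matrix_vector_mult_add_rdistrib scaleR_matrix_vector_assoc)
  then show ?thesis
    by (simp add: inner_add_right form1 form2 algebra_simps)
qed

end

text \<open>With \<open>A\<close>, \<open>B\<close>, \<open>G\<close> below, the form of the pencil in the frame is \<open>A x\<^sup>2 + B y\<^sup>2 - G z\<^sup>2\<close>. In the unit disc the inner conic
is thus the ellipse with squared semiaxes \<open>G / A\<close> and \<open>G / B\<close>.\<close>

locale poncelet_pencil = poncelet_frame +
  fixes \<nu> :: "real \<times> real"
  assumes pos: "snd \<nu> > 0" "fst \<nu> + l3 * snd \<nu> > 0"
begin

definition A where "A = fst \<nu> + l1 * snd \<nu>"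
definition B where "B = fst \<nu> + l2 * snd \<nu>"
definition G where "G = fst \<nu> + l3 * snd \<nu>"

lemma ABG: "A > B" "B > G" "G > 0"
  using pos ord unfolding A_def B_def G_def by simp_all

abbreviation N where "N \<equiv> pencil C1 C2 \<nu>"

lemma formN: "(T *v x) \<bullet> (N *v (T *v y)) = A * (x $ 1 * y $ 1) + B * (x $ 2 * y $ 2) - G * (x $ 3 * y $ 3)"
  unfolding A_def B_def G_def by (rule form_pencil)

sublocale inner_ellipse "G / A" "G / B"
  by unfold_locales (use ABG in \<open>simp_all add: divide_strict_left_mono\<close>)

abbreviation gap where "gap \<equiv> tangent_gap (G / A) (G / B)"
abbreviation hchord where "hchord \<equiv> half_chord (G / A) (G / B)"

lemma pencil_curve_inside:
  assumes "p \<in> conic_curve N"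
  obtains x where "x \<in> cone" "x $ 3 = 1" "p = pt x" "A * (x $ 1)\<^sup>2 + B * (x $ 2)\<^sup>2 = G"
    "homog p \<bullet> (C1 *v homog p) < 0"
proof -
  obtain u where u: "homog p = T *v u" using T_surj by blast
  have eq: "A * (u $ 1)\<^sup>2 + B * (u $ 2)\<^sup>2 = G * (u $ 3)\<^sup>2"
    using assms unfolding conic_curve_def mem_Collect_eq u formN by (simp add: power2_eq_square)
  have "(u $ 1)\<^sup>2 + (u $ 2)\<^sup>2 < (u $ 3)\<^sup>2"
  proof (rule ccontr)
    assume "\<not> ?thesis"
    then have ge: "G * (u $ 3)\<^sup>2 \<le> G * (u $ 1)\<^sup>2 + G * (u $ 2)\<^sup>2"
      using ABG by (simp add: distrib_left[symmetric])
    have "(A - G) * (u $ 1)\<^sup>2 + (B - G) * (u $ 2)\<^sup>2 \<le> 0"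
      using eq ge by (simp add: algebra_simps)
    moreover have "(A - G) * (u $ 1)\<^sup>2 \<ge> 0" "(B - G) * (u $ 2)\<^sup>2 \<ge> 0" using ABG by simp_all
    ultimately have "(A - G) * (u $ 1)\<^sup>2 = 0 \<and> (B - G) * (u $ 2)\<^sup>2 = 0" by linarith
    then have "u $ 1 = 0 \<and> u $ 2 = 0" using ABG by simp
    with eq ABG have "u = 0" by (simp add: vec_eq_iff forall_3)
    then have "homog p $ 3 = 0" by (simp add: u)
    then show False by (simp add: homog_def)
  qed
  then have neg: "homog p \<bullet> (C1 *v homog p) < 0" unfolding u form1 by (simp add: power2_eq_square)
  from point_in_cone[OF less_imp_le[OF neg]]
  obtain x where x: "x \<in> cone" "x $ 3 = 1" "p = pt x" by blast
  have "(T *v x) \<bullet> (N *v (T *v x)) = 0"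
    using assms height_pos[OF x(1)] unfolding conic_curve_def mem_Collect_eq x(3) form_pt[OF x(1) x(1)] by simp
  then have "A * (x $ 1)\<^sup>2 + B * (x $ 2)\<^sup>2 = G" unfolding formN x(2) by (simp add: power2_eq_square)
  then show ?thesis using that[OF x _ neg] by blast
qed

lemma pt_on_pencil_curve:
  assumes "x \<in> cone" "A * (x $ 1)\<^sup>2 + B * (x $ 2)\<^sup>2 = G * (x $ 3)\<^sup>2"
  shows "pt x \<in> conic_curve N"
  using assms(2) unfolding conic_curve_def mem_Collect_eq form_pt[OF assms(1) assms(1)] formN
  by (simp add: power2_eq_square)

text \<open>Two opposite points of the inner ellipse: they show that it is nonempty, and that a line having it on one side
has the centre of the disc on that side.\<close>

lemma axis_point:
  assumes "\<epsilon> = 1 \<or> \<epsilon> = - 1"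
  defines "z \<equiv> vector [\<epsilon> * sqrt (G / A), 0, 1] :: real ^ 3"
  shows "z \<in> cone" "pt z \<in> conic_curve N"
proof -
  have sq: "(\<epsilon> * sqrt (G / A))\<^sup>2 = G / A" using assms(1) ABG by (auto simp: power_mult_distrib)
  show "z \<in> cone" unfolding cone_def z_def using sq ABG by simp
  then show "pt z \<in> conic_curve N"
    by (rule pt_on_pencil_curve) (use sq ABG in \<open>simp add: z_def\<close>)
qed

text \<open>The point where the chord of normal direction \<open>s\<close> touches the inner ellipse, in homogeneous coordinates.\<close>

definition touch :: "real \<Rightarrow> real ^ 3" where
  "touch s = vector [G / A * cos s, G / B * sin s, cos (hchord s)]"

lemma touch_in_cone: "touch s \<in> cone"
proof -
  have "t\<^sup>2 \<le> t" if "0 < t" "t < 1" for t :: real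
    using that mult_left_le[of t t] by (simp add: power2_eq_square)
  from this[of "G / A"] this[of "G / B"] ab
  have "(G / A)\<^sup>2 \<le> G / A" "(G / B)\<^sup>2 \<le> G / B" by simp_all
  then have "(G / A * cos s)\<^sup>2 \<le> G / A * (cos s)\<^sup>2" "(G / B * sin s)\<^sup>2 \<le> G / B * (sin s)\<^sup>2"
    unfolding power_mult_distrib by (simp_all only: mult_right_mono zero_le_power2)
  then have "(G / A * cos s)\<^sup>2 + (G / B * sin s)\<^sup>2 \<le> (cos (hchord s))\<^sup>2"
    unfolding cos_half_chord_squared tangent_gap_def by linarith
  then show ?thesis unfolding cone_def touch_def using sin_cos_half_chord_pos[of s] by simp
qed

lemma touch_on_curve: "pt (touch s) \<in> conic_curve N"
proof (rule pt_on_pencil_curve[OF touch_in_cone])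
  show "A * (touch s $ 1)\<^sup>2 + B * (touch s $ 2)\<^sup>2 = G * (touch s $ 3)\<^sup>2"
    unfolding touch_def using ABG
    by (simp add: cos_half_chord_squared tangent_gap_def power_mult_distrib power_divide) (simp add: field_simps power2_eq_square)
qed

lemma touch_conjugate:
  assumes "e = 1 \<or> e = - 1"
  shows "(T *v touch s) \<bullet> (N *v (T *v circ (s + e * hchord s))) = 0"
proof -
  have "cos s * cos (s + e * hchord s) + sin s * sin (s + e * hchord s) = cos (e * hchord s)"
    using cos_diff[of "s + e * hchord s" s] by (simp add: mult.commute)
  also have "\<dots> = cos (hchord s)" using assms by auto
  finally have "cos s * cos (s + e * hchord s) + sin s * sin (s + e * hchord s) = cos (hchord s)" .
  moreover have "(T *v touch s) \<bullet> (N *v (T *v circ (s + e * hchord s))) =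
      G * (cos s * cos (s + e * hchord s) + sin s * sin (s + e * hchord s) - cos (hchord s))"
    unfolding formN touch_def using ABG by (simp add: field_simps)
  ultimately show ?thesis by simp
qed

text \<open>The coefficient of each endpoint is proportional to the distance from the tangency point to the other
endpoint; \<open>touching_point_between\<close> makes both positive.\<close>

lemma touch_between: "pt (touch s) \<in> closed_segment (\<psi> (s - hchord s)) (\<psi> (s + hchord s))"
  unfolding \<psi>_def
proof (rule closed_segment_pt[OF circ_in_cone circ_in_cone touch_in_cone])
  let ?d = "hchord s" and ?q = "(G / B - G / A) * sin s * cos s"
  let ?\<alpha> = "(sin ?d * cos ?d - ?q) / (2 * sin ?d)" and ?\<beta> = "(sin ?d * cos ?d + ?q) / (2 * sin ?d)"
  have sd: "sin ?d > 0" "sin ?d \<noteq> 0" using sin_cos_half_chord_pos[of s] by simp_all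
  have sum: "?\<alpha> + ?\<beta> = cos ?d" and dif: "(?\<beta> - ?\<alpha>) * sin ?d = ?q"
    using sd by (simp_all add: field_simps)
  have X: "cos ?d * cos ?d = G / A * (cos s)\<^sup>2 + G / B * (sin s)\<^sup>2"
    using cos_half_chord_squared[of s] unfolding tangent_gap_def by (simp add: power2_eq_square)
  have one: "(sin s)\<^sup>2 + (cos s)\<^sup>2 = 1" by simp
  have "?\<alpha> * cos (s - ?d) + ?\<beta> * cos (s + ?d) = (?\<alpha> + ?\<beta>) * (cos s * cos ?d) - ((?\<beta> - ?\<alpha>) * sin ?d) * sin s"
    unfolding cos_diff cos_add by (simp only: algebra_simps)
  also have "\<dots> = (cos ?d * cos ?d) * cos s - ?q * sin s"
    unfolding sum dif by simp
  also have "\<dots> = G / A * cos s" unfolding X using one by algebra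
  finally have 1: "?\<alpha> * cos (s - ?d) + ?\<beta> * cos (s + ?d) = G / A * cos s" .
  have "?\<alpha> * sin (s - ?d) + ?\<beta> * sin (s + ?d) = (?\<alpha> + ?\<beta>) * (sin s * cos ?d) + ((?\<beta> - ?\<alpha>) * sin ?d) * cos s"
    unfolding sin_diff sin_add by (simp only: algebra_simps)
  also have "\<dots> = (cos ?d * cos ?d) * sin s + ?q * cos s"
    unfolding sum dif by simp
  also have "\<dots> = G / B * sin s" unfolding X using one by algebra
  finally have 2: "?\<alpha> * sin (s - ?d) + ?\<beta> * sin (s + ?d) = G / B * sin s" .
  show "touch s = ?\<alpha> *\<^sub>R circ (s - ?d) + ?\<beta> *\<^sub>R circ (s + ?d)"
    unfolding vec_eq_iff forall_3 touch_def using 1 2 sum by (simp del: times_divide_eq_left times_divide_eq_right)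
  show "0 \<le> ?\<alpha>" "0 \<le> ?\<beta>" using touching_point_between[of s] sd by (simp_all add: abs_less_iff)
qed

lemma tangent_segment_chord: "tangent_segment N (\<psi> (s - hchord s)) (\<psi> (s + hchord s))"
proof -
  let ?p = "pt (touch s)"
  have conj: "homog ?p \<bullet> (N *v homog (\<psi> (s - hchord s))) = 0" "homog ?p \<bullet> (N *v homog (\<psi> (s + hchord s))) = 0"
    unfolding \<psi>_def using touch_conjugate[of "-1" s] touch_conjugate[of 1 s]
    by (simp_all add: form_pt touch_in_cone circ_in_cone)
  have "closed_segment (\<psi> (s - hchord s)) (\<psi> (s + hchord s)) \<subseteq> tangent_line N ?p"
  proof
    fix q assume "q \<in> closed_segment (\<psi> (s - hchord s)) (\<psi> (s + hchord s))"
    then obtain u where "q = (1 - u) *\<^sub>R \<psi> (s - hchord s) + u *\<^sub>R \<psi> (s + hchord s)"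
      by (auto simp: in_segment)
    then show "q \<in> tangent_line N ?p"
      by (simp add: tangent_line_def homog_affine matrix_vector_right_distrib matrix_vector_mult_scaleR inner_add_right conj)
  qed
  moreover have "\<psi> (s - hchord s) \<noteq> \<psi> (s + hchord s)"
  proof
    assume "\<psi> (s - hchord s) = \<psi> (s + hchord s)"
    then obtain k :: int where "- hchord s = hchord s + 2 * pi * of_int k" unfolding \<psi>_eq_iff by auto
    then have "hchord s = pi * of_int (- k)" by simp
    moreover have "0 < hchord s" "hchord s < pi * 1" using half_chord_bounds[of s] pi_gt_zero by simp_all
    ultimately have "0 < pi * of_int (- k)" "pi * of_int (- k) < pi * 1" by metis+
    then have "0 < real_of_int (- k)" "real_of_int (- k) < 1"
      by (simp_all only: zero_less_mult_iff mult_less_cancel_left_pos[OF pi_gt_zero]) auto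
    then show False unfolding of_int_0_less_iff of_int_less_1_iff by simp
  qed
  ultimately show ?thesis
    unfolding tangent_segment_def using touch_between[of s] touch_on_curve[of s] by blast
qed

lemma on_left_chord: "on_left (conic_curve N) (\<psi> (s - hchord s)) (\<psi> (s + hchord s))"
  unfolding on_left_def
proof
  fix q assume "q \<in> conic_curve N"
  then obtain x where x: "x \<in> cone" "x $ 3 = 1" "q = pt x" "A * (x $ 1)\<^sup>2 + B * (x $ 2)\<^sup>2 = G"
    by (rule pencil_curve_inside) (rule that)
  have "x $ 1 * cos s + x $ 2 * sin s \<le> cos (hchord s)"
    unfolding cos_half_chord
  proof (rule real_le_rsqrt)
    \<comment> \<open>Cauchy-Schwarz, with its defect written as a square.\<close>
    have "gap s - (x $ 1 * cos s + x $ 2 * sin s)\<^sup>2 = (B * (x $ 2) * cos s - A * (x $ 1) * sin s)\<^sup>2 / (A * B)"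
    proof -
      have "A * B * (gap s - (x $ 1 * cos s + x $ 2 * sin s)\<^sup>2) =
         B * G * (cos s)\<^sup>2 + A * G * (sin s)\<^sup>2 - A * B * (x $ 1 * cos s + x $ 2 * sin s)\<^sup>2"
        unfolding tangent_gap_def using ABG by (simp add: field_simps)
      also have "\<dots> = (B * (x $ 2) * cos s - A * (x $ 1) * sin s)\<^sup>2"
        unfolding x(4)[symmetric] by algebra
      finally show ?thesis using ABG by (simp add: field_simps)
    qed
    moreover have "0 \<le> (B * (x $ 2) * cos s - A * (x $ 1) * sin s)\<^sup>2 / (A * B)" using ABG by simp
    ultimately show "(x $ 1 * cos s + x $ 2 * sin s)\<^sup>2 \<le> gap s" by linarith
  qed
  then have "x \<bullet> cross3 (circ (s - hchord s)) (circ (s + hchord s)) \<ge> 0"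
    unfolding chord_triple x(2) using sin_cos_half_chord_pos[of s] by simp
  then show "0 \<le> cross2 (\<psi> (s + hchord s) - \<psi> (s - hchord s)) (q - \<psi> (s - hchord s))"
    unfolding \<psi>_def x(3) by (simp add: cross2_pt_sign circ_in_cone x(1))
qed

text \<open>Tangency means that the form of the pencil restricted to the span of the two endpoints is degenerate,
so its Gram determinant vanishes; by the Lagrange identity this is \<open>cos\<^sup>2 d = a cos\<^sup>2 s + b sin\<^sup>2 s\<close>. Having the
ellipse on the left selects the root with \<open>cos d \<ge> 0\<close>.\<close>

lemma left_tangent_chord_unique:
  assumes "0 < d" "d < pi" and tangent: "tangent_segment N (\<psi> (s - d)) (\<psi> (s + d))"
    and left: "on_left (conic_curve N) (\<psi> (s - d)) (\<psi> (s + d))"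
  shows "d = hchord s"
proof -
  let ?x = "circ (s - d)" and ?y = "circ (s + d)"
  have sd: "sin d > 0" using assms by (simp add: sin_gt_zero)
  have "cos d - \<epsilon> * sqrt (G / A) * cos s \<ge> 0" if \<epsilon>: "\<epsilon> = 1 \<or> \<epsilon> = - 1" for \<epsilon>
  proof -
    let ?z = "vector [\<epsilon> * sqrt (G / A), 0, 1] :: real ^ 3"
    have "cross2 (pt ?y - pt ?x) (pt ?z - pt ?x) \<ge> 0"
      using left axis_point[OF \<epsilon>] unfolding on_left_def \<psi>_def by blast
    then have "?z \<bullet> cross3 ?x ?y \<ge> 0"
      unfolding cross2_pt_sign(1)[OF circ_in_cone circ_in_cone axis_point(1)[OF \<epsilon>]] .
    then show ?thesis unfolding chord_triple using sd by (simp add: zero_le_mult_iff)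
  qed
  from this[of 1] this[of "-1"] have cos_nonneg: "0 \<le> cos d" by simp
  obtain p where p: "p \<in> closed_segment (\<psi> (s - d)) (\<psi> (s + d))"
      "closed_segment (\<psi> (s - d)) (\<psi> (s + d)) \<subseteq> tangent_line N p"
    using tangent unfolding tangent_segment_def by blast
  then obtain u where u: "p = (1 - u) *\<^sub>R \<psi> (s - d) + u *\<^sub>R \<psi> (s + d)" by (auto simp: in_segment)
  define \<alpha> \<beta> where "\<alpha> = (1 - u) / (T *v ?x) $ 3" and "\<beta> = u / (T *v ?y) $ 3"
  have h: "(T *v ?x) $ 3 > 0" "(T *v ?y) $ 3 > 0" by (simp_all add: height_pos circ_in_cone)
  have hp: "homog p = T *v (\<alpha> *\<^sub>R ?x + \<beta> *\<^sub>R ?y)"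
    unfolding u homog_affine \<psi>_def \<alpha>_def \<beta>_def
    by (simp add: homog_pt circ_in_cone matrix_vector_right_distrib matrix_vector_mult_scaleR)
  have "homog p \<bullet> (N *v homog (pt ?x)) = 0" "homog p \<bullet> (N *v homog (pt ?y)) = 0"
    using p(2) unfolding \<psi>_def tangent_line_def by auto
  then have z: "(T *v (\<alpha> *\<^sub>R ?x + \<beta> *\<^sub>R ?y)) \<bullet> (N *v (T *v ?x)) = 0"
      "(T *v (\<alpha> *\<^sub>R ?x + \<beta> *\<^sub>R ?y)) \<bullet> (N *v (T *v ?y)) = 0"
    unfolding hp using h by (simp_all add: homog_pt circ_in_cone matrix_vector_mult_scaleR)
  define x1 x2 y1 y2 where "x1 = cos (s - d)" and "x2 = sin (s - d)" and "y1 = cos (s + d)" and "y2 = sin (s + d)"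
  define N00 N01 N11 where "N00 = A * x1\<^sup>2 + B * x2\<^sup>2 - G" and "N01 = A * x1 * y1 + B * x2 * y2 - G"
    and "N11 = A * y1\<^sup>2 + B * y2\<^sup>2 - G"
  have "\<alpha> * N00 + \<beta> * N01 = 0" "\<alpha> * N01 + \<beta> * N11 = 0"
    using z unfolding formN N00_def N01_def N11_def x1_def x2_def y1_def y2_def
    by (simp_all add: power2_eq_square algebra_simps)
  then have "\<alpha> * (N00 * N11 - N01\<^sup>2) = 0" "\<beta> * (N00 * N11 - N01\<^sup>2) = 0" by algebra+
  moreover have "\<alpha> \<noteq> 0 \<or> \<beta> \<noteq> 0" using h unfolding \<alpha>_def \<beta>_def by auto
  ultimately have "N00 * N11 - N01\<^sup>2 = 0" by auto
  moreover have "N00 * N11 - N01\<^sup>2 = A * B * (x1 * y2 - x2 * y1)\<^sup>2 - A * G * (x1 - y1)\<^sup>2 - B * G * (x2 - y2)\<^sup>2"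
    unfolding N00_def N01_def N11_def by algebra
  moreover have "x1 - y1 = 2 * sin d * sin s" "y2 - x2 = 2 * sin d * cos s"
    unfolding x1_def y1_def x2_def y2_def by (simp_all add: cos_diff cos_add sin_diff sin_add)
  moreover have "x1 * y2 - x2 * y1 = 2 * sin d * cos d"
  proof -
    have "x1 * y2 - x2 * y1 = sin ((s + d) - (s - d))"
      unfolding x1_def y1_def x2_def y2_def sin_diff[of "s + d" "s - d"] by simp
    then show ?thesis by (simp add: sin_double)
  qed
  moreover have "(x2 - y2)\<^sup>2 = (y2 - x2)\<^sup>2" by (rule power2_commute)
  ultimately have "(2 * sin d)\<^sup>2 * (A * B * (cos d)\<^sup>2 - A * G * (sin s)\<^sup>2 - B * G * (cos s)\<^sup>2) = 0"
    by (simp add: power_mult_distrib algebra_simps)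
  then have "A * B * (cos d)\<^sup>2 = A * G * (sin s)\<^sup>2 + B * G * (cos s)\<^sup>2" using sd by simp
  then have "(cos d)\<^sup>2 = gap s" unfolding tangent_gap_def using ABG by (simp add: field_simps)
  then show ?thesis using half_chord_unique cos_nonneg assms by simp
qed

text \<open>Every angle is the start of exactly one chord (\<open>chord_start_surj\<close>, \<open>chord_start_inj\<close>), so this determines
the Poncelet map on the whole ellipse.\<close>

lemma poncelet_map_chord: "poncelet_map C1 C2 \<nu> (\<psi> (s - hchord s)) = \<psi> (s + hchord s)"
  unfolding poncelet_map_def
proof (rule the_equality)
  show "\<psi> (s + hchord s) \<in> conic_curve C1 \<and> tangent_segment N (\<psi> (s - hchord s)) (\<psi> (s + hchord s)) \<and>
      on_left (conic_curve N) (\<psi> (s - hchord s)) (\<psi> (s + hchord s))"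
    using tangent_segment_chord on_left_chord by (simp add: conic1_eq_range)
next
  fix z1 assume z1: "z1 \<in> conic_curve C1 \<and> tangent_segment N (\<psi> (s - hchord s)) z1 \<and>
      on_left (conic_curve N) (\<psi> (s - hchord s)) z1"
  define \<theta> where "\<theta> = s - hchord s"
  obtain \<theta>' where \<theta>': "z1 = \<psi> \<theta>'" using z1 conic1_eq_range by blast
  \<comment> \<open>Choose the angle of \<open>z1\<close> in the turn that starts at \<open>\<theta>\<close>.\<close>
  define k where "k = \<lfloor>(\<theta>' - \<theta>) / (2 * pi)\<rfloor>"
  define \<theta>1 where "\<theta>1 = \<theta>' + 2 * pi * of_int (- k)"
  have z1_eq: "z1 = \<psi> \<theta>1" unfolding \<theta>' \<psi>_eq_iff \<theta>1_def by (rule exI[of _ k]) simp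
  have "of_int k \<le> (\<theta>' - \<theta>) / (2 * pi)" "(\<theta>' - \<theta>) / (2 * pi) < of_int k + 1"
    unfolding k_def by linarith+
  then have "\<theta> \<le> \<theta>1" "\<theta>1 < \<theta> + 2 * pi"
    unfolding \<theta>1_def by (simp_all add: field_simps)
  moreover have "\<theta> \<noteq> \<theta>1" using z1 unfolding z1_eq \<theta>_def tangent_segment_def by auto
  ultimately have \<theta>1: "\<theta> < \<theta>1" "\<theta>1 < \<theta> + 2 * pi" by simp_all
  define s' d where "s' = (\<theta> + \<theta>1) / 2" and "d = (\<theta>1 - \<theta>) / 2"
  have sd: "\<theta> = s' - d" "\<theta>1 = s' + d" by (simp_all add: s'_def d_def field_simps)
  have "d = hchord s'"
  proof (rule left_tangent_chord_unique)
    show "0 < d" "d < pi" using \<theta>1 by (simp_all add: d_def)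
    show "tangent_segment N (\<psi> (s' - d)) (\<psi> (s' + d))" "on_left (conic_curve N) (\<psi> (s' - d)) (\<psi> (s' + d))"
      using z1 unfolding sd[symmetric] z1_eq \<theta>_def by simp_all
  qed
  then have "s' - hchord s' = s - hchord s" using sd(1) \<theta>_def by simp
  then have "s' = s" by (rule chord_start_inj)
  then show "z1 = \<psi> (s + hchord s)" unfolding z1_eq sd(2) using \<open>d = hchord s'\<close> by simp
qed

text \<open>In the coordinate \<open>H\<close> on the outer ellipse the Poncelet map is the translation by \<open>c\<close>. Since
\<open>0 < c < L\<close>, the quotient \<open>c / L\<close> is the representative in \<open>[0, 1)\<close>.\<close>

lemma poncelet_rotation_number_eq:
  assumes H: "\<And>x. (H has_real_derivative 1 / sqrt ((l1 - l3) * (cos x)\<^sup>2 + (l2 - l3) * (sin x)\<^sup>2)) (at x)"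
  shows "poncelet_rotation_number C1 C2 \<nu> = (H (hchord 0) - H (- hchord 0)) / (H (2 * pi) - H 0)"
proof -
  let ?w = "\<lambda>x. 1 / sqrt ((l1 - l3) * (cos x)\<^sup>2 + (l2 - l3) * (sin x)\<^sup>2)"
  have wpos: "?w x > 0" for x using weight_pos[of "l1 - l3" "l2 - l3" x] ord by simp
  have "H x < H y" if "x < y" for x y
    by (rule DERIV_pos_imp_increasing[OF that]) (use H wpos in blast)
  then have monoH: "strict_mono H" by (rule strict_monoI)
  have contH: "continuous_on UNIV H"
    using H DERIV_isCont by (auto simp: continuous_on_eq_continuous_at)
  define L where "L = H (2 * pi) - H 0"
  have perH: "H (x + 2 * pi) = H x + L" for x
  proof -
    have "((\<lambda>x. H (x + 2 * pi) - H x) has_real_derivative 0) (at x)" for x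
    proof -
      have "((\<lambda>x. H (x + 2 * pi)) has_real_derivative ?w (x + 2 * pi)) (at x)"
        using H[of "x + 2 * pi"] by (simp add: DERIV_shift)
      from DERIV_diff[OF this H[of x]] show ?thesis by simp
    qed
    from DERIV_isconst_all[OF allI[OF this], of x 0] show ?thesis by (simp add: L_def)
  qed
  have Lpos: "L > 0" unfolding L_def using strict_monoD[OF monoH, of 0 "2 * pi"] by simp
  define c where "c = H (hchord 0) - H (- hchord 0)"
  have chord: "H (s + hchord s) - H (s - hchord s) = c" for s
    unfolding c_def
  proof (rule chord_measure_constant[OF H])
    \<comment> \<open>The ratio of the second form on the circle to the weight of \<open>chord_endpoint_weight\<close>.\<close>
    show "0 < A * B / (G * snd \<nu>)" using ABG pos by simp
    have "(1 - G / A) * (G / B) = G * ((l1 - l3) * snd \<nu>) / (A * B)" "(1 - G / B) * (G / A) = G * ((l2 - l3) * snd \<nu>) / (A * B)"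
      using ABG by (simp_all add: field_simps) (simp_all add: A_def B_def G_def algebra_simps)
    then show "l1 - l3 = A * B / (G * snd \<nu>) * ((1 - G / A) * (G / B))"
      "l2 - l3 = A * B / (G * snd \<nu>) * ((1 - G / B) * (G / A))"
      using ABG pos by simp_all
  qed
  have map: "poncelet_map C1 C2 \<nu> (\<psi> \<theta>) = \<psi> \<theta>'" if "H \<theta>' = H \<theta> + c" for \<theta> \<theta>'
  proof -
    obtain s where s: "s - hchord s = \<theta>" using chord_start_surj by blast
    have "H \<theta>' = H (s + hchord s)" using chord[of s] that s by simp
    then have "\<theta>' = s + hchord s" using monoH by (simp add: strict_mono_eq)
    then show ?thesis using poncelet_map_chord[of s] s by simp
  qed
  obtain \<beta> where \<beta>: "continuous_on UNIV \<beta>" "strict_mono \<beta>" "\<And>t. \<beta> (t + 1) = \<beta> t + 2 * pi"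
    "\<And>t. ellipse_param C1 t = \<psi> (\<beta> t)"
    by (rule ellipse_param_reparametrizes) (rule that)
  have d: "0 < hchord 0" "hchord 0 < pi / 2" by (rule half_chord_bounds)+
  have "c > 0" unfolding c_def using strict_monoD[OF monoH, of "- hchord 0" "hchord 0"] d by simp
  moreover have "c < L"
  proof -
    have "H (hchord 0) < H (- hchord 0 + 2 * pi)" using strict_monoD[OF monoH, of "hchord 0" "- hchord 0 + 2 * pi"] d by simp
    then show ?thesis unfolding perH c_def by simp
  qed
  moreover have "rotation_number (ellipse_param C1) (poncelet_map C1 C2 \<nu>) = c / L"
    if "0 \<le> c / L" "c / L < 1"
  proof (rule rotation_number_eqI[where J = "\<lambda>t. H (\<beta> t) / L"])
    show "continuous_on UNIV (\<lambda>t. H (\<beta> t) / L)"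
      by (intro continuous_intros continuous_on_compose2[OF contH \<beta>(1)]) (use Lpos in auto)
    show "strict_mono (\<lambda>t. H (\<beta> t) / L)"
      by (rule strict_monoI, rule divide_strict_right_mono[OF strict_monoD[OF monoH strict_monoD[OF \<beta>(2)]] Lpos])
    show "H (\<beta> (t + 1)) / L = H (\<beta> t) / L + 1" for t
      unfolding \<beta>(3) perH using Lpos by (simp add: add_divide_distrib)
    show "poncelet_map C1 C2 \<nu> (ellipse_param C1 t) = ellipse_param C1 t'" if "H (\<beta> t') / L = H (\<beta> t) / L + c / L" for t t'
      unfolding \<beta>(4) by (rule map) (use that Lpos in \<open>simp add: field_simps\<close>)
    show "s - t \<in> \<int>" if "ellipse_param C1 s = ellipse_param C1 t" for s t
    proof -
      have \<beta>int: "\<beta> (t + of_int k) = \<beta> t + 2 * pi * of_int k" for k t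
      proof (induction k rule: int_induct[where k = 0])
        case (step1 i)
        then show ?case using \<beta>(3)[of "t + of_int i"] by (simp add: algebra_simps)
      next
        case (step2 i)
        then show ?case using \<beta>(3)[of "t + of_int (i - 1)"] by (simp add: algebra_simps)
      qed simp
      from that obtain k :: int where "\<beta> s = \<beta> t + 2 * pi * of_int k" unfolding \<beta>(4) \<psi>_eq_iff by blast
      then have "\<beta> s = \<beta> (t + of_int k)" by (simp add: \<beta>int)
      then have "s = t + of_int k" using \<beta>(2) by (simp add: strict_mono_eq)
      then show ?thesis by simp
    qed
  qed (use that in auto)
  ultimately show ?thesis
    unfolding poncelet_rotation_number_def c_def L_def by (simp add: L_def)
qed

end

context poncelet_frame
begin

lemma conic_inclusion_iff:
  assumes "poncelet_pencil C1 C2 T l1 l2 l3 \<nu>" "poncelet_pencil C1 C2 T l1 l2 l3 \<mu>"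
  shows "conic_curve (pencil C1 C2 \<mu>) \<subseteq> conic_interior (pencil C1 C2 \<nu>) \<longleftrightarrow> cross2 \<nu> \<mu> > 0"
proof -
  interpret M: poncelet_pencil C1 C2 T l1 l2 l3 \<mu> by fact
  have mu: "snd \<mu> > 0" by (rule M.pos)
  have key: "p \<in> conic_interior (pencil C1 C2 \<nu>) \<longleftrightarrow> cross2 \<nu> \<mu> > 0" if "p \<in> conic_curve (pencil C1 C2 \<mu>)" for p
  proof -
    let ?a = "homog p \<bullet> (C1 *v homog p)" and ?b = "homog p \<bullet> (C2 *v homog p)"
    have neg: "?a < 0" by (rule M.pencil_curve_inside[OF that])
    have form: "homog p \<bullet> (pencil C1 C2 \<xi> *v homog p) = fst \<xi> * ?a + snd \<xi> * ?b" for \<xi>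
      unfolding pencil_def by (simp add: matrix_vector_mult_add_rdistrib inner_add_right flip: scaleR_matrix_vector_assoc)
    have "fst \<mu> * ?a + snd \<mu> * ?b = 0" using that unfolding conic_curve_def mem_Collect_eq form .
    then have "snd \<mu> * (fst \<nu> * ?a + snd \<nu> * ?b) = cross2 \<nu> \<mu> * ?a" unfolding cross2_def by algebra
    moreover have "p \<in> conic_interior (pencil C1 C2 \<nu>) \<longleftrightarrow> fst \<nu> * ?a + snd \<nu> * ?b < 0"
      unfolding conic_interior_def mem_Collect_eq form ..
    moreover have "fst \<nu> * ?a + snd \<nu> * ?b < 0 \<longleftrightarrow> snd \<mu> * (fst \<nu> * ?a + snd \<nu> * ?b) < 0"
      using mu by (simp add: mult_less_0_iff)
    moreover have "cross2 \<nu> \<mu> * ?a < 0 \<longleftrightarrow> cross2 \<nu> \<mu> > 0"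
      using neg by (simp add: mult_less_0_iff)
    ultimately show ?thesis by simp
  qed
  have "conic_curve (pencil C1 C2 \<mu>) \<noteq> {}" using M.axis_point(2)[of 1] by auto
  then show ?thesis using key by blast
qed

text \<open>The same \<open>H\<close> gives both rotation numbers, so they are ordered as the half-chords at \<open>s = 0\<close>.\<close>

lemma rotation_number_less_iff:
  assumes "poncelet_pencil C1 C2 T l1 l2 l3 \<nu>" "poncelet_pencil C1 C2 T l1 l2 l3 \<mu>"
  shows "poncelet_rotation_number C1 C2 \<nu> < poncelet_rotation_number C1 C2 \<mu> \<longleftrightarrow> cross2 \<nu> \<mu> > 0"
proof -
  interpret N: poncelet_pencil C1 C2 T l1 l2 l3 \<nu> by fact
  interpret M: poncelet_pencil C1 C2 T l1 l2 l3 \<mu> by fact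
  let ?w = "\<lambda>x. 1 / sqrt ((l1 - l3) * (cos x)\<^sup>2 + (l2 - l3) * (sin x)\<^sup>2)"
  have wpos: "?w x > 0" for x using weight_pos[of "l1 - l3" "l2 - l3" x] ord by simp
  have "sqrt ((l1 - l3) * (cos x)\<^sup>2 + (l2 - l3) * (sin x)\<^sup>2) \<noteq> 0" for x using wpos[of x] by auto
  then have "continuous_on UNIV ?w" by (intro continuous_intros) auto
  then obtain H where H: "\<And>x. (H has_real_derivative ?w x) (at x)"
    by (rule continuous_antiderivative_exists) (rule that)
  have monoH: "H x < H y" if "x < y" for x y
    by (rule DERIV_pos_imp_increasing[OF that]) (use H wpos in blast)
  have L: "H (2 * pi) - H 0 > 0" using monoH[of 0 "2 * pi"] by simp
  have mono: "H x - H (- x) < H y - H (- y) \<longleftrightarrow> x < y" for x y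
    using monoH[of x y] monoH[of "- y" "- x"] monoH[of y x] monoH[of "- x" "- y"] by (cases x y rule: linorder_cases) auto
  have "poncelet_rotation_number C1 C2 \<nu> < poncelet_rotation_number C1 C2 \<mu> \<longleftrightarrow> N.hchord 0 < M.hchord 0"
    unfolding N.poncelet_rotation_number_eq[OF H] M.poncelet_rotation_number_eq[OF H]
    using L by (simp add: divide_less_cancel mono)
  also have "\<dots> \<longleftrightarrow> M.G / M.A < N.G / N.A"
  proof -
    have "arccos x < arccos y \<longleftrightarrow> y < x" if "0 < x" "x < 1" "0 < y" "y < 1" for x y :: real
      using that arccos_less_mono[of x y] by simp
    moreover have "N.hchord 0 = arccos (sqrt (N.G / N.A))" "M.hchord 0 = arccos (sqrt (M.G / M.A))"
      by (simp_all add: half_chord_def tangent_gap_def)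
    ultimately show ?thesis using N.ab M.ab by simp
  qed
  also have "\<dots> \<longleftrightarrow> 0 < N.G * M.A - M.G * N.A"
    using N.ABG M.ABG by (simp add: divide_less_eq less_divide_eq field_simps)
  also have "N.G * M.A - M.G * N.A = (l1 - l3) * cross2 \<nu> \<mu>"
    unfolding N.A_def N.G_def M.A_def M.G_def cross2_def by algebra
  also have "0 < (l1 - l3) * cross2 \<nu> \<mu> \<longleftrightarrow> cross2 \<nu> \<mu> > 0"
    using ord by (simp add: zero_less_mult_iff)
  finally show ?thesis .
qed

end

theorem theorem3:
  fixes C1 C2 :: "real ^ 3 ^ 3"
    and l1 l2 l3 :: real
    and \<nu> \<mu> :: "real \<times> real"
  assumes "transpose C1 = C1" and "transpose C2 = C2"
    and "positive_definite (upper_left C1)" and "det C1 < 0"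
    and "positive_definite (upper_left C2)" and "det C2 < 0"
    and "eigenvalues (matrix_inv C1 ** C2) = {l1, l2, l3}"
    and "l1 > l2" and "l2 > l3" and "l3 > 0"
    and "\<And>u :: real ^ 3. u \<noteq> 0 \<Longrightarrow> u \<bullet> (C2 *v u) = 0 \<Longrightarrow> u \<bullet> (C1 *v u) < 0"
    and "snd \<nu> > 0" and "fst \<nu> + l3 * snd \<nu> > 0"
    and "snd \<mu> > 0" and "fst \<mu> + l3 * snd \<mu> > 0"
  shows "(conic_curve (pencil C1 C2 \<mu>) \<subseteq> conic_interior (pencil C1 C2 \<nu>) \<longleftrightarrow> cross2 \<nu> \<mu> > 0) \<and>
         (cross2 \<nu> \<mu> > 0 \<longleftrightarrow>
            poncelet_rotation_number C1 C2 \<mu> > poncelet_rotation_number C1 C2 \<nu>)"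
proof -
  obtain T :: "real ^ 3 ^ 3"
    where T: "\<And>x y. (T *v x) \<bullet> (C1 *v (T *v y)) = x $ 1 * y $ 1 + x $ 2 * y $ 2 - x $ 3 * y $ 3"
      "\<And>x y. (T *v x) \<bullet> (C2 *v (T *v y)) = l1 * (x $ 1 * y $ 1) + l2 * (x $ 2 * y $ 2) - l3 * (x $ 3 * y $ 3)"
      "det T > 0" "T $ 3 $ 3 > 0"
    by (rule common_frame_exists[OF assms(1-4,7-10) assms(11)]) (assumption | rule that)+
  interpret poncelet_frame C1 C2 T l1 l2 l3
    by unfold_locales (fact T assms)+
  have "poncelet_pencil C1 C2 T l1 l2 l3 \<nu>" "poncelet_pencil C1 C2 T l1 l2 l3 \<mu>"
    by (unfold_locales; fact assms)+
  then show ?thesis using conic_inclusion_iff rotation_number_less_iff by blast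
qed

end
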